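(* Let $n\ge 3$ and let $\gamma=(\gamma_0,\dots,\gamma_n)$ and $\lambda=(\lambda_0,\dots,\lambda_n)$ be two sequences of parameters in $\{1,-1\}$. If the graphs $\Gamma_e(\mathcal A^{\gamma}_{n+1})$ and $\Gamma_e(\mathcal A^{\lambda}_{n+1})$ are isomorphic, then the algebras $\mathcal A^{\gamma}_{n+1}$ and $\mathcal A^{\lambda}_{n+1}$ are also isomorphic.
   Context: Cayley–Dickson algebras: $\mathcal A_0=\mathbb R$ with trivial conjugation and basis element $e^{(0)}_0=1$. For $\gamma_k\in\{1,-1\}$, $\mathcal A_{k+1}=\mathcal A_k\{\gamma_k\}$ consists of pairs $(a,b)$ of elements of $\mathcal A_k$ with componentwise linear operations, product $(a,b)(c,d)=(ac+\gamma_k\bar d b,\ da+b\bar c)$ and conjugation $\overline{(a,b)}=(\bar a,-b)$; $\mathcal A^{\gamma}_{n+1}=\mathcal A_{n+1}\{\gamma_0,\dots,\gamma_n\}$ denotes the algebra obtained from $\mathbb R$ with successive parameters $\gamma_0,\dots,\gamma_n$. The standard basis of $\mathcal A_{k+1}$ is $e^{(k+1)}_j=(e^{(k)}_j,0)$ for $0\le j<2^k$ and $e^{(k+1)}_j=(0,e^{(k)}_{j-2^k})$ for $2^k\le j<2^{k+1}$. $\mathcal E_n$ is the standard basis of $\mathcal A_n$, $e_0$ is the unit, $\mathcal E'_n=\mathcal E_n\setminus\{e_0\}$. Two elements $u,v$ of an algebra are orthogonal if $uv=vu=0$. The graph $\Gamma_e(\mathcal A_{n+1})$: vertices are the lines $\mathbb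 R(a,b)\subset\mathcal A_{n+1}$ spanned by zero divisors $(a,b)$ with $a\in\mathcal E'_n$, $b\in\pm\mathcal E_n$; two distinct lines are adjacent iff their generators are orthogonal. *)

theory Defs
  imports Complex_Main "HOL-Algebra.Module" "HOL-Algebra.QuotRing" "Graph_Theory.Digraph_Isomorphism" "Graph_Theory.Pair_Digraph"
begin

section \<open>Cayley-Dickson algebras over the reals\<close>

text \<open>
  A single type holds the elements of all the algebras: those obtained from the real numbers by
  \<open>k\<close> doublings are the terms in which every branch has depth \<open>k\<close> (\<open>cd_carrier k\<close>).
  The equations below are only meant for arguments of equal depth.
\<close>

datatype cd = Scalar real | Dbl cd cd

primrec cd_carrier :: "nat \<Rightarrow> cd set" where
  "cd_carrier 0 = range Scalar"
| "cd_carrier (Suc k) = {Dbl a b | a b. a \<in> cd_carrier k \<and> b \<in> cd_carrier k}"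

primrec cd_zero :: "nat \<Rightarrow> cd" where
  "cd_zero 0 = Scalar 0"
| "cd_zero (Suc k) = Dbl (cd_zero k) (cd_zero k)"

fun cd_add :: "cd \<Rightarrow> cd \<Rightarrow> cd" where
  "cd_add (Scalar x) (Scalar y) = Scalar (x + y)"
| "cd_add (Dbl a b) (Dbl c d) = Dbl (cd_add a c) (cd_add b d)"
| "cd_add _ _ = undefined"

primrec cd_scale :: "real \<Rightarrow> cd \<Rightarrow> cd" where
  "cd_scale r (Scalar x) = Scalar (r * x)"
| "cd_scale r (Dbl a b) = Dbl (cd_scale r a) (cd_scale r b)"

abbreviation cd_neg :: "cd \<Rightarrow> cd" where
  "cd_neg \<equiv> cd_scale (- 1)"

primrec cd_conj :: "cd \<Rightarrow> cd" where
  "cd_conj (Scalar x) = Scalar x"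
| "cd_conj (Dbl a b) = Dbl (cd_conj a) (cd_neg b)"

text \<open>
  The number argument of \<open>cd_mult\<close> is the number of doublings; doubling number \<open>k + 1\<close>
  uses the parameter \<open>\<gamma> k\<close>.
\<close>

fun cd_mult :: "(nat \<Rightarrow> real) \<Rightarrow> nat \<Rightarrow> cd \<Rightarrow> cd \<Rightarrow> cd" where
  "cd_mult \<gamma> 0 (Scalar x) (Scalar y) = Scalar (x * y)"
| "cd_mult \<gamma> (Suc k) (Dbl a b) (Dbl c d) =
     Dbl (cd_add (cd_mult \<gamma> k a c) (cd_scale (\<gamma> k) (cd_mult \<gamma> k (cd_conj d) b)))
         (cd_add (cd_mult \<gamma> k d a) (cd_mult \<gamma> k b (cd_conj c)))"
| "cd_mult _ _ _ _ = undefined"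

primrec cd_basis :: "nat \<Rightarrow> nat \<Rightarrow> cd" where
  "cd_basis 0 j = Scalar 1"
| "cd_basis (Suc k) j =
     (if j < 2 ^ k then Dbl (cd_basis k j) (cd_zero k) else Dbl (cd_zero k) (cd_basis k (j - 2 ^ k)))"

definition cd_basis_set :: "nat \<Rightarrow> cd set" where
  "cd_basis_set k = cd_basis k ` {..<2 ^ k}"

text \<open>
  \<open>cd_algebra \<gamma> k\<close> is obtained from the real numbers with the parameters
  \<open>\<gamma> 0, ..., \<gamma> (k - 1)\<close>. The record type is used for its signature only: the product is not
  associative in general.
\<close>

definition cd_algebra :: "(nat \<Rightarrow> real) \<Rightarrow> nat \<Rightarrow> (real, cd) module" where
  "cd_algebra \<gamma> k =
     \<lparr>carrier = cd_carrier k, monoid.mult = cd_mult \<gamma> k, one = cd_basis k 0,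
      zero = cd_zero k, add = cd_add, smult = cd_scale\<rparr>"

definition alg_isomorphic :: "('r, 'a, 'm) module_scheme \<Rightarrow> ('r, 'b, 'n) module_scheme \<Rightarrow> bool" where
  "alg_isomorphic A B \<longleftrightarrow>
     (\<exists>\<phi> \<in> ring_iso A B. \<forall>r. \<forall>x \<in> carrier A. \<phi> (r \<odot>\<^bsub>A\<^esub> x) = r \<odot>\<^bsub>B\<^esub> \<phi> x)"


section \<open>The graph of zero divisors built from standard basis elements\<close>

definition orthogonal_elems :: "('a, 'm) ring_scheme \<Rightarrow> 'a \<Rightarrow> 'a \<Rightarrow> bool" where
  "orthogonal_elems A u v \<longleftrightarrow> u \<otimes>\<^bsub>A\<^esub> v = \<zero>\<^bsub>A\<^esub> \<and> v \<otimes>\<^bsub>A\<^esub> u = \<zero>\<^bsub>A\<^esub>"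

definition zero_divisors :: "('a, 'm) ring_scheme \<Rightarrow> 'a set" where
  "zero_divisors A =
     {u \<in> carrier A - {\<zero>\<^bsub>A\<^esub>}. \<exists>v \<in> carrier A - {\<zero>\<^bsub>A\<^esub>}. u \<otimes>\<^bsub>A\<^esub> v = \<zero>\<^bsub>A\<^esub> \<or> v \<otimes>\<^bsub>A\<^esub> u = \<zero>\<^bsub>A\<^esub>}"

definition line :: "cd \<Rightarrow> cd set" where
  "line u = range (\<lambda>r. cd_scale r u)"

definition basis_zero_divisors :: "(nat \<Rightarrow> real) \<Rightarrow> nat \<Rightarrow> cd set" where
  "basis_zero_divisors \<gamma> n =
     {Dbl a b | a b. a \<in> cd_basis_set n - {cd_basis n 0} \<and>
                     b \<in> cd_basis_set n \<union> cd_neg ` cd_basis_set n} \<inter>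
     zero_divisors (cd_algebra \<gamma> (Suc n))"

text \<open>An undirected edge is represented by the two arcs between its end points.\<close>

definition Gamma_e :: "(nat \<Rightarrow> real) \<Rightarrow> nat \<Rightarrow> cd set pair_pre_digraph" where
  "Gamma_e \<gamma> n =
     \<lparr>pverts = line ` basis_zero_divisors \<gamma> n,
      parcs = {(line u, line v) | u v.
                 u \<in> basis_zero_divisors \<gamma> n \<and> v \<in> basis_zero_divisors \<gamma> n \<and>
                 line u \<noteq> line v \<and> orthogonal_elems (cd_algebra \<gamma> (Suc n)) u v}\<rparr>"

definition graph_isomorphic :: "'a pair_pre_digraph \<Rightarrow> 'b pair_pre_digraph \<Rightarrow> bool" where
  "graph_isomorphic G H \<longleftrightarrow> digraph_iso (with_proj G) (with_proj H)"

lemma pair_wf_digraph_Gamma_e: "pair_wf_digraph (Gamma_e \<gamma> n)"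
  by unfold_locales (auto simp: Gamma_e_def)

lemma symmetric_Gamma_e: "sym (parcs (Gamma_e \<gamma> n))"
  unfolding sym_def Gamma_e_def orthogonal_elems_def by simp metis

lemma graph_isomorphic_Gamma_e_iff:
  "graph_isomorphic (Gamma_e \<gamma> n) (Gamma_e \<mu> m) \<longleftrightarrow>
     (\<exists>f. bij_betw f (pverts (Gamma_e \<gamma> n)) (pverts (Gamma_e \<mu> m)) \<and>
          (\<forall>L \<in> pverts (Gamma_e \<gamma> n). \<forall>M \<in> pverts (Gamma_e \<gamma> n).
             (L, M) \<in> parcs (Gamma_e \<gamma> n) \<longleftrightarrow> (f L, f M) \<in> parcs (Gamma_e \<mu> m)))"
  (is "_ \<longleftrightarrow> ?rhs")
proof -
  let ?G = "Gamma_e \<gamma> n" and ?H = "Gamma_e \<mu> m"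
  have inV: "\<And>L M. (L, M) \<in> parcs (Gamma_e \<delta> k) \<Longrightarrow>
      L \<in> pverts (Gamma_e \<delta> k) \<and> M \<in> pverts (Gamma_e \<delta> k)" for \<delta> k
    by (auto simp: Gamma_e_def)
  show ?thesis
  proof
    assume "graph_isomorphic ?G ?H"
    then obtain h where h: "pre_digraph.digraph_isomorphism (with_proj ?G) h"
      and H: "with_proj ?H = app_iso h (with_proj ?G)"
      by (auto simp: graph_isomorphic_def digraph_iso_def)
    let ?f = "iso_verts h"
    have V: "pverts ?H = ?f ` pverts ?G" and E: "parcs ?H = iso_arcs h ` parcs ?G"
      and t: "iso_tail h = fst" and hd: "iso_head h = snd"
      using arg_cong[OF H, of verts] arg_cong[OF H, of arcs]
        arg_cong[OF H, of tail] arg_cong[OF H, of head] by simp_all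
    have inj: "inj_on ?f (pverts ?G)"
      and arc: "\<And>e. e \<in> parcs ?G \<Longrightarrow> iso_arcs h e = (?f (fst e), ?f (snd e))"
      using h t hd by (auto simp: pre_digraph.digraph_isomorphism_def intro: prod_eqI)
    have "(L, M) \<in> parcs ?G \<longleftrightarrow> (?f L, ?f M) \<in> parcs ?H"
      if LM: "L \<in> pverts ?G" "M \<in> pverts ?G" for L M
    proof
      assume "(L, M) \<in> parcs ?G"
      then show "(?f L, ?f M) \<in> parcs ?H" using arc[of "(L, M)"] E by force
    next
      assume "(?f L, ?f M) \<in> parcs ?H"
      then obtain e where e: "e \<in> parcs ?G" "(?f L, ?f M) = (?f (fst e), ?f (snd e))"
        using arc E by force
      then have "fst e = L" "snd e = M"
        using LM inj inV[of "fst e" "snd e"] by (auto dest: inj_onD)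
      then show "(L, M) \<in> parcs ?G" using e by (metis prod.collapse)
    qed
    then show ?rhs using V inj by (intro exI[of _ ?f]) (auto simp: bij_betw_def)
  next
    assume ?rhs
    then obtain f where f: "bij_betw f (pverts ?G) (pverts ?H)"
      and fe: "\<And>L M. L \<in> pverts ?G \<Longrightarrow> M \<in> pverts ?G \<Longrightarrow>
                 (L, M) \<in> parcs ?G \<longleftrightarrow> (f L, f M) \<in> parcs ?H"
      by blast
    define h where "h = \<lparr>iso_verts = f, iso_arcs = map_prod f f, iso_head = snd, iso_tail = fst\<rparr>"
    have inj: "inj_on f (pverts ?G)" and img: "f ` pverts ?G = pverts ?H"
      using f by (simp_all add: bij_betw_imp_inj_on bij_betw_imp_surj_on)
    have E: "map_prod f f ` parcs ?G = parcs ?H"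
    proof (intro subset_antisym subsetI)
      fix e assume "e \<in> map_prod f f ` parcs ?G"
      then obtain L M where "(L, M) \<in> parcs ?G" "e = (f L, f M)" by auto
      then show "e \<in> parcs ?H" using fe[of L M] inV[of L M] by simp
    next
      fix e assume e: "e \<in> parcs ?H"
      then have "fst e \<in> f ` pverts ?G" "snd e \<in> f ` pverts ?G"
        using inV[of "fst e" "snd e"] img by simp_all
      then obtain L M where LM: "L \<in> pverts ?G" "M \<in> pverts ?G" and "fst e = f L" "snd e = f M"
        by blast
      then have eq: "e = map_prod f f (L, M)" by (simp add: prod_eq_iff)
      then have "(L, M) \<in> parcs ?G" using fe[OF LM] e by simp
      then show "e \<in> map_prod f f ` parcs ?G" unfolding eq by (rule imageI)
    qed
    have "inj_on (map_prod f f) (parcs ?G)"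
    proof (rule inj_onI)
      fix d e assume de: "d \<in> parcs ?G" "e \<in> parcs ?G" "map_prod f f d = map_prod f f e"
      then have "f (fst d) = f (fst e)" "f (snd d) = f (snd e)"
        by (cases d; cases e; simp)+
      then show "d = e"
        using de inV[of "fst d" "snd d"] inV[of "fst e" "snd e"] inj_onD[OF inj]
        by (intro prod_eqI) simp_all
    qed
    then have "pre_digraph.digraph_isomorphism (with_proj ?G) h"
      using inj pair_wf_digraph_Gamma_e
      by (simp add: pre_digraph.digraph_isomorphism_def h_def wf_digraph_wp_iff)
    moreover have "with_proj ?H = app_iso h (with_proj ?G)"
      using img E by (simp add: app_iso_def h_def with_proj_def)
    ultimately show "graph_isomorphic ?G ?H"
      by (auto simp: graph_isomorphic_def digraph_iso_def)
  qed
qed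

end

theory Submission
  imports Defs
begin

text \<open>
  Index the standard basis by bit vectors, so that products of basis elements are basis elements up to
  sign. Lines spanned by \<open>(e\<^sub>i, \<plusminus>e\<^sub>i\<^sub>+\<^sub>t)\<close> and \<open>(e\<^sub>k, \<plusminus>e\<^sub>k\<^sub>+\<^sub>t')\<close> can only be adjacent
  if \<open>t = t'\<close>, and then adjacency is governed by the product of the character
  \<open>\<chi>(t) = \<Prod>(-\<gamma>\<^sub>j)\<close> over the bits \<open>j\<close> of \<open>t\<close> and a sign \<open>\<omega>(t, i, k)\<close> that does not depend on the
  parameters at all. Hence the degree of a vertex is a number \<open>M(t, i)\<close> or \<open>2\<^sup>n - 2 - M(t, i)\<close>,
  according to \<open>\<chi>(t)\<gamma>\<^sub>n\<close>, and the two cases are told apart modulo 4. So the graph determines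
  \<open>\<gamma>\<^sub>n\<close> and the number of pairs \<open>(t, i)\<close> with prescribed \<open>M(t, i)\<close> and \<open>\<chi>(t)\<close>; the recursion of these
  numbers in \<open>n\<close> reveals \<open>\<gamma>\<^sub>3, \<dots>, \<gamma>\<^sub>n\<close> and whether \<open>\<gamma>\<^sub>0 = \<gamma>\<^sub>1 = \<gamma>\<^sub>2 = -1\<close>. These data determine the
  algebra, since all choices of \<open>\<gamma>\<^sub>0, \<gamma>\<^sub>1, \<gamma>\<^sub>2\<close> other than \<open>-1, -1, -1\<close> give the split octonions.
\<close>

section \<open>Signs of products of basis elements\<close>

text \<open>
  Basis elements are indexed by bit vectors whose head belongs to the last doubling. Signs are booleans,
  \<^const>\<open>True\<close> standing for \<open>-1\<close>; in particular \<open>g k\<close> means that \<open>\<gamma>\<^sub>k = -1\<close>.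
\<close>

fun vadd :: "bool list \<Rightarrow> bool list \<Rightarrow> bool list" (infixl "\<triangle>" 65) where
  "(a # x) \<triangle> (b # y) = (a \<noteq> b) # (x \<triangle> y)"
| "x \<triangle> y = []"

definition nonzero :: "bool list \<Rightarrow> bool" where
  "nonzero x \<longleftrightarrow> True \<in> set x"

lemma nonzero_simps [simp]: "\<not> nonzero []" "nonzero (a # x) \<longleftrightarrow> a \<or> nonzero x"
  by (auto simp: nonzero_def)

lemma length_vadd [simp]: "length x = length y \<Longrightarrow> length (x \<triangle> y) = length y"
  by (induction x y rule: list_induct2) auto

lemma vadd_commute: "x \<triangle> y = y \<triangle> x"
  by (induction x y rule: vadd.induct) auto

lemma vadd_cancel [simp]:
  assumes "length x = length y"
  shows "x \<triangle> (x \<triangle> y) = y" "x \<triangle> (y \<triangle> x) = y" "(x \<triangle> y) \<triangle> x = y" "(y \<triangle> x) \<triangle> x = y"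
  using assms by (induction x y rule: list_induct2) auto

lemma nonzero_vadd [simp]: "length x = length y \<Longrightarrow> nonzero (x \<triangle> y) \<longleftrightarrow> x \<noteq> y"
  by (induction x y rule: list_induct2) auto

lemma vadd_zero:
  assumes "length x = length y" "\<not> nonzero y"
  shows "x \<triangle> y = x" "y \<triangle> x = x"
  using assms by (induction x y rule: list_induct2) auto

lemma zero_unique: "length x = length y \<Longrightarrow> \<not> nonzero x \<Longrightarrow> \<not> nonzero y \<Longrightarrow> x = y"
  by (induction x y rule: list_induct2) auto

lemma vadd_left_cancel [simp]:
  "length x = length y \<Longrightarrow> length z = length y \<Longrightarrow> x \<triangle> y = x \<triangle> z \<longleftrightarrow> y = z"
  by (metis vadd_cancel(1))

lemma vadd_right_cancel [simp]:
  "length x = length y \<Longrightarrow> length z = length y \<Longrightarrow> y \<triangle> x = z \<triangle> x \<longleftrightarrow> y = z"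
  by (metis vadd_cancel(4))

lemma vadd_eq_self [simp]:
  assumes "length x = length y"
  shows "x \<triangle> y = x \<longleftrightarrow> \<not> nonzero y" "y \<triangle> x = x \<longleftrightarrow> \<not> nonzero y"
    "x = x \<triangle> y \<longleftrightarrow> \<not> nonzero y" "x = y \<triangle> x \<longleftrightarrow> \<not> nonzero y"
  using assms by (induction x y rule: list_induct2) auto

section \<open>Multiplication table up to sign, and the norm character\<close>

function sgn_mult :: "(nat \<Rightarrow> bool) \<Rightarrow> bool list \<Rightarrow> bool list \<Rightarrow> bool" where
  "sgn_mult g (a # x) (b # y) =
     (if a then (if b then (g (length x) \<noteq> (nonzero y \<noteq> sgn_mult g y x)) else nonzero y \<noteq> sgn_mult g x y)
      else if b then sgn_mult g y x else sgn_mult g x y)"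
| "sgn_mult g [] y = False"
| "sgn_mult g (a # x) [] = False"
  by pat_completeness auto
termination by (relation "measure (\<lambda>(g, x, y). length x + length y)") auto

text \<open>This is the sign of the norm: by \<open>sgn_mult_self\<close>, a basis element times its
  conjugate is the unit with this sign. That norms of basis elements multiply is
  \<open>chi_vadd\<close>.\<close>

fun chi :: "(nat \<Rightarrow> bool) \<Rightarrow> bool list \<Rightarrow> bool" where
  "chi g [] = False"
| "chi g (a # x) = ((a \<and> \<not> g (length x)) \<noteq> chi g x)"

lemma chi_zero [simp]: "\<not> nonzero x \<Longrightarrow> \<not> chi g x"
  by (induction x) auto

lemma chi_vadd: "length x = length y \<Longrightarrow> chi g (x \<triangle> y) = (chi g x \<noteq> chi g y)"
  by (induction x y rule: list_induct2) auto

lemma sgn_mult_zero: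
  assumes "length x = length y" "\<not> nonzero y"
  shows "\<not> sgn_mult g x y" "\<not> sgn_mult g y x"
  using assms by (induction x y rule: list_induct2) auto

text \<open>Conjugation reverses products and negates every basis element except the unit; if both
  factors and their product are non-units, this forces anticommutation. The induction checks it
  doubling by doubling.\<close>

lemma sgn_mult_commute:
  "length x = length y \<Longrightarrow>
     sgn_mult g y x = (sgn_mult g x y \<noteq> (nonzero x \<and> nonzero y \<and> x \<noteq> y))"
proof (induction x y rule: list_induct2)
  case (Cons a x b y)
  then show ?case by (cases a; cases b) (auto simp: sgn_mult_zero dest: zero_unique)
qed auto

lemma sgn_mult_self: "sgn_mult g x x = (nonzero x \<noteq> chi g x)"
  by (induction x) auto

text \<open>This is the left alternative law u(uv) = (uu)v for basis elements. It survives all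
  doublings, although alternativity of the whole algebra does not.\<close>

lemma sgn_mult_vadd_left:
  "length t = length i \<Longrightarrow> sgn_mult g t (t \<triangle> i) = (sgn_mult g t i \<noteq> sgn_mult g t t)"
proof (induction t i rule: list_induct2)
  case (Cons a t b i)
  then show ?case
    using sgn_mult_commute[of t i g] sgn_mult_commute[of t "t \<triangle> i" g] zero_unique[of t i]
    by (cases a; cases b; cases "t = i"; cases "nonzero t"; cases "nonzero i"; cases "sgn_mult g t i";
      cases "sgn_mult g t t"; simp)
qed auto

lemma sgn_mult_vadd:
  assumes "length t = length i"
  shows "sgn_mult g t (t \<triangle> i) = (sgn_mult g t i \<noteq> sgn_mult g t t)"
    "sgn_mult g t (i \<triangle> t) = (sgn_mult g t i \<noteq> sgn_mult g t t)"
    "sgn_mult g (t \<triangle> i) t = (sgn_mult g i t \<noteq> sgn_mult g t t)"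
    "sgn_mult g (i \<triangle> t) t = (sgn_mult g i t \<noteq> sgn_mult g t t)"
  using assms sgn_mult_vadd_left[of t i g] sgn_mult_commute[of t i g] sgn_mult_commute[of t "t \<triangle> i" g]
    zero_unique[of t i]
  by (simp_all add: vadd_commute[of i t])
    (cases "t = i"; cases "nonzero t"; cases "nonzero i"; cases "sgn_mult g t i"; cases "sgn_mult g t t"; simp)+

text \<open>Linear independence over the field with two elements.\<close>

definition ind2 :: "bool list \<Rightarrow> bool list \<Rightarrow> bool" where
  "ind2 t i \<longleftrightarrow> nonzero t \<and> nonzero i \<and> t \<noteq> i"

definition ind3 :: "bool list \<Rightarrow> bool list \<Rightarrow> bool list \<Rightarrow> bool" where
  "ind3 t i k \<longleftrightarrow> ind2 t i \<and> nonzero k \<and> k \<noteq> t \<and> k \<noteq> i \<and> k \<noteq> t \<triangle> i"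

text \<open>The recursion is dictated by \<open>theta_Cons\<close> and
  \<open>theta_Cons_new\<close>: the sign is True at the doubling where the triple becomes
  independent, and afterwards flips with every set head bit of the first vector; the other heads no
  longer matter.\<close>

fun omega :: "bool list \<Rightarrow> bool list \<Rightarrow> bool list \<Rightarrow> bool" where
  "omega (a # t) (b # i) (c # k) =
     (if ind3 t i k then a \<noteq> omega t i k else ind3 (a # t) (b # i) (c # k))"
| "omega _ _ _ = False"

text \<open>The product of (e_i, +-e_{i+t}) and (e_k, +-e_{k+t}) has two components, each a sum of
  two signed copies of one basis element. Cancellation in the second component relates the two free
  signs; once they are eliminated, this is what cancellation in the first requires, apart from the
  last parameter.\<close>

definition theta :: "(nat \<Rightarrow> bool) \<Rightarrow> bool list \<Rightarrow> bool list \<Rightarrow> bool list \<Rightarrow> bool" where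
  "theta g t i k = (sgn_mult g i k \<noteq> (sgn_mult g (k \<triangle> t) i \<noteq> (sgn_mult g (i \<triangle> t) k \<noteq>
     (nonzero (k \<triangle> t) \<noteq> sgn_mult g (k \<triangle> t) (i \<triangle> t)))))"

text \<open>With a linear relation between the indices, the alternative laws and anticommutation
  reduce the product of signs to signs of squares, which \<open>chi\<close> evaluates.\<close>

lemma theta_dependent:
  assumes [simp]: "length t = n" "length i = n" "length k = n"
    and "nonzero i" "nonzero k" "\<not> ind3 t i k"
  shows "theta g t i k = (\<not> chi g t)"
proof -
  consider "\<not> nonzero t" | "nonzero t" "t = i" "t = k" | "nonzero t" "t = i" "t \<noteq> k"
    | "nonzero t" "t = k" "t \<noteq> i" | "k = i" "t \<noteq> i" "nonzero t" | "k = t \<triangle> i" "t \<noteq> i" "nonzero t"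
    using assms unfolding ind3_def ind2_def by blast
  then show ?thesis
  proof cases
    case 1
    then show ?thesis using assms
      by (cases "k = i"; cases "sgn_mult g i k")
        (simp_all add: theta_def vadd_zero sgn_mult_zero sgn_mult_commute[of i k] sgn_mult_self)
  next
    case 2
    then show ?thesis using assms
      by (simp add: theta_def sgn_mult_zero sgn_mult_self)
  next
    case 3
    then show ?thesis using assms
      by (cases "sgn_mult g i k"; cases "chi g i")
        (simp_all add: theta_def sgn_mult_zero sgn_mult_self sgn_mult_vadd sgn_mult_commute[of i k])
  next
    case 4
    then show ?thesis using assms
      by (cases "sgn_mult g i k"; cases "chi g k")
        (simp_all add: theta_def sgn_mult_zero sgn_mult_self sgn_mult_vadd)
  next
    case 5
    then show ?thesis using assms
      by (cases "chi g t"; cases "chi g i"; cases "sgn_mult g (i \<triangle> t) i")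
       (simp_all add: theta_def sgn_mult_zero sgn_mult_self chi_vadd)
  next
    case 6
    then show ?thesis using assms
      by (cases "chi g t"; cases "chi g i"; cases "sgn_mult g i (t \<triangle> i)")
        (simp_all add: theta_def sgn_mult_zero sgn_mult_self chi_vadd vadd_commute[of i t])
  qed
qed

text \<open>All four products in \<open>theta\<close> have distinct non-unit factors here, so swaps
  and conjugations cost known signs. The parameter enters bc + (a+c)b + (a+b)c + (a+c)(a+b) times,
  which is a modulo 2.\<close>

lemma theta_Cons:
  assumes [simp]: "length t = n" "length i = n" "length k = n"
    and "ind3 t i k"
  shows "theta g (a # t) (b # i) (c # k) = (theta g t i k \<noteq> (a \<and> g n))"
proof -
  have nz: "nonzero t" "nonzero i" "nonzero k" "k \<noteq> t" "k \<noteq> i" "t \<noteq> i" "i \<noteq> t" "k \<triangle> t \<noteq> i" "i \<triangle> t \<noteq> k" "k \<triangle> t \<noteq> i \<triangle> t"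
    using assms by (auto simp: ind3_def ind2_def vadd_commute)
  have c: "sgn_mult g k i = (\<not> sgn_mult g i k)"
    "sgn_mult g i (k \<triangle> t) = (\<not> sgn_mult g (k \<triangle> t) i)"
    "sgn_mult g k (i \<triangle> t) = (\<not> sgn_mult g (i \<triangle> t) k)"
    "sgn_mult g (i \<triangle> t) (k \<triangle> t) = (\<not> sgn_mult g (k \<triangle> t) (i \<triangle> t))"
    using nz sgn_mult_commute[of i k g] sgn_mult_commute[of "k \<triangle> t" i g] sgn_mult_commute[of "i \<triangle> t" k g]
       sgn_mult_commute[of "k \<triangle> t" "i \<triangle> t" g] by auto
  show ?thesis
    by (cases a; cases b; cases c; simp only: theta_def vadd.simps sgn_mult.simps if_True if_False
      simp_thms c nz nonzero_simps length_vadd assms nonzero_vadd; argo)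
qed

text \<open>Dependence of the tails means that one of their seven nontrivial combinations vanishes;
  these are the seven cases. Independence of the longer vectors then restricts the heads, and the
  rules for two generators evaluate the signs.\<close>

lemma theta_Cons_new:
  assumes [simp]: "length t = n" "length i = n" "length k = n"
    and "\<not> ind3 t i k" "ind3 (a # t) (b # i) (c # k)"
  shows "theta g (a # t) (b # i) (c # k) = chi g (a # t)"
proof -
  note ind = assms(5)[unfolded ind3_def ind2_def nonzero_simps vadd.simps list.inject de_Morgan_conj]
  consider "\<not> nonzero t" | "nonzero t" "\<not> nonzero i" | "nonzero t" "nonzero i" "\<not> nonzero k"
    | "nonzero i" "nonzero k" "t = i" | "nonzero i" "nonzero k" "t = k" "i \<noteq> k"
    | "nonzero t" "nonzero i" "k = i" "t \<noteq> i" | "nonzero t" "nonzero i" "k = t \<triangle> i" "t \<noteq> i"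
    using assms(4) unfolding ind3_def ind2_def by blast
  then show ?thesis
  proof cases
    case 1
    have *: "nonzero i" using ind 1 zero_unique[of t i] by auto
    have **: "nonzero k" using ind 1 zero_unique[of t k] by auto
    have ***: "k \<noteq> i" using ind 1 vadd_zero[of i t] by auto
    with 1 * ** *** show ?thesis using assms(5)
      by (cases a; cases b; cases c; simp add: theta_def ind3_def ind2_def vadd_zero sgn_mult_zero sgn_mult_self sgn_mult_commute[of i k]) (argo+)?
  next
    case 2
    have **: "nonzero k" using ind 2 zero_unique[of i k] by auto
    have ***: "k \<noteq> t" using ind 2 vadd_zero[of t i] by auto
    with 2 ** *** show ?thesis using assms(5)
      by (cases a; cases b; cases c; simp add: theta_def ind3_def ind2_def vadd_zero sgn_mult_zero sgn_mult_self sgn_mult_vadd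
          sgn_mult_commute[of t k]) (argo+)?
  next
    case 3
    have *: "t \<noteq> i" using ind 3 zero_unique[of k "t \<triangle> i"] by auto
    with 3 * show ?thesis using assms(5)
      by (cases a; cases b; cases c; simp add: theta_def ind3_def ind2_def vadd_zero sgn_mult_zero sgn_mult_self sgn_mult_vadd
          sgn_mult_commute[of t i]) (argo+)?
  next
    case 4
    have *: "k \<noteq> i" using ind 4 by auto
    with 4 * show ?thesis using assms(5)
      by (cases a; cases b; cases c; simp add: theta_def ind3_def ind2_def vadd_zero sgn_mult_zero sgn_mult_self sgn_mult_vadd
          sgn_mult_commute[of i k]) (argo+)?
  next
    case 5
    then show ?thesis using assms(5)
      by (cases a; cases b; cases c; simp add: theta_def ind3_def ind2_def vadd_zero sgn_mult_zero sgn_mult_self sgn_mult_vadd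
          sgn_mult_commute[of i k]) (argo+)?
  next
    case 6
    then show ?thesis using assms(5)
      by (cases a; cases b; cases c; simp add: theta_def ind3_def ind2_def vadd_zero sgn_mult_zero sgn_mult_self sgn_mult_vadd chi_vadd
          sgn_mult_commute[of i t] vadd_commute[of t i]) (argo+)?
  next
    case 7
    then show ?thesis using assms(5)
      by (cases a; cases b; cases c; simp add: theta_def ind3_def ind2_def vadd_zero sgn_mult_zero sgn_mult_self sgn_mult_vadd chi_vadd
          sgn_mult_commute[of i t] vadd_commute[of t i]) (argo+)?
  qed
qed

text \<open>Each step of \<open>theta_Cons\<close> contributes \<open>a \<and> g n\<close>, which is
  the exclusive or of \<open>a\<close> and \<open>a \<and> \<not> g n\<close>: the former goes into
  \<open>omega\<close>, the latter into \<open>chi\<close>. The descent ends where the triple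
  becomes independent.\<close>

lemma theta_eq:
  assumes "length t = n" "length i = n" "length k = n" "nonzero i" "nonzero k"
  shows "theta g t i k = (\<not> chi g t \<noteq> omega t i k)"
proof (cases "ind3 t i k")
  case True
  with assms(1-3) show ?thesis
  proof (induction n arbitrary: t i k)
    case 0
    then show ?case by (simp add: ind3_def ind2_def)
  next
    case (Suc n)
    obtain a t' b i' c k' where [simp]: "t = a # t'" "i = b # i'" "k = c # k'"
      using Suc.prems by (metis length_Suc_conv)
    show ?case
    proof (cases "ind3 t' i' k'")
      case True
      then show ?thesis using Suc by (cases a) (auto simp: theta_Cons[where n=n])
    next
      case False
      then show ?thesis using Suc.prems by (simp add: theta_Cons_new[where n=n] del: chi.simps)
    qed
  qed
next
  case False
  then have "\<not> omega t i k" by (induction t i k rule: omega.induct) (auto simp: ind3_def ind2_def)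
  with False assms show ?thesis by (simp add: theta_dependent[where n=n])
qed

section \<open>Counting\<close>

definition vecs :: "nat \<Rightarrow> bool list set" where
  "vecs n = {x. length x = n}"

lemma vecs_iff [simp]: "x \<in> vecs n \<longleftrightarrow> length x = n"
  by (simp add: vecs_def)

lemma vecs_0 [simp]: "vecs 0 = {[]}"
  by (auto simp: vecs_def)

lemma vecs_Suc: "vecs (Suc n) = Cons False ` vecs n \<union> Cons True ` vecs n"
  by (auto simp: vecs_def length_Suc_conv image_iff)

lemma finite_vecs [simp]: "finite (vecs n)"
  by (induction n) (simp_all add: vecs_Suc)

lemma finite_vecs_filter [simp]: "finite {x :: bool list. length x = n \<and> P x}"
  by (rule finite_subset[OF _ finite_vecs[of n]]) auto

lemma sum_vecs_Suc: "sum f (vecs (Suc n)) = (\<Sum>x\<in>vecs n. f (False # x) + f (True # x))"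
  for f :: "bool list \<Rightarrow> nat"
proof -
  have "sum f (vecs (Suc n)) = sum f (Cons False ` vecs n) + sum f (Cons True ` vecs n)"
    unfolding vecs_Suc by (rule sum.union_disjoint) auto
  then show ?thesis by (simp add: sum.reindex sum.distrib)
qed

lemma card_vecs [simp]: "card (vecs n) = 2 ^ n"
proof (induction n)
  case (Suc n)
  then show ?case using sum_vecs_Suc[of "\<lambda>_. 1" n] by simp
qed simp

lemma card_filter_sum: "finite A \<Longrightarrow> card {x \<in> A. P x} = (\<Sum>x\<in>A. of_bool (P x))"
  by (simp add: sum.If_cases of_bool_def Int_def)

lemma not_nonzero_replicate [simp]: "\<not> nonzero (replicate n False)"
  by (simp add: nonzero_def)

lemma zero_vec: "length x = n \<Longrightarrow> \<not> nonzero x \<longleftrightarrow> x = replicate n False"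
  by (metis length_replicate not_nonzero_replicate zero_unique)

lemma card_nonzero: "card {x \<in> vecs n. nonzero x} = 2 ^ n - 1"
proof -
  have "{x \<in> vecs n. nonzero x} = vecs n - {replicate n False}"
    using zero_vec by (simp only: set_eq_iff mem_Collect_eq Diff_iff singleton_iff vecs_iff) metis
  then show ?thesis by (simp add: card_Diff_subset)
qed

lemma card_filter_not: "card {x \<in> vecs n. P x} + card {x \<in> vecs n. \<not> P x} = 2 ^ n"
proof -
  have "card ({x \<in> vecs n. P x} \<union> {x \<in> vecs n. \<not> P x}) = card {x \<in> vecs n. P x} + card {x \<in> vecs n. \<not> P x}"
    by (rule card_Un_disjoint) auto
  moreover have "{x \<in> vecs n. P x} \<union> {x \<in> vecs n. \<not> P x} = vecs n" by auto
  ultimately show ?thesis by simp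
qed

lemma card_ind3:
  assumes "length t = n" "length i = n" "ind2 t i"
  shows "card {k \<in> vecs n. ind3 t i k} = 2 ^ n - 4" "card {k \<in> vecs n. \<not> ind3 t i k} = 4"
proof -
  \<comment> \<open>The span of \<open>t\<close> and \<open>i\<close>.\<close>
  let ?D = "{replicate n False, t, i, t \<triangle> i}"
  have eq: "{k \<in> vecs n. \<not> ind3 t i k} = ?D"
    using assms zero_vec unfolding ind3_def
    by (simp only: set_eq_iff mem_Collect_eq insert_iff empty_iff vecs_iff) (metis length_vadd length_replicate)
  have "card ?D = 4"
    using assms zero_vec[of t n] zero_vec[of i n] zero_vec[of "t \<triangle> i" n]
    by (simp add: ind2_def card_insert_if)
  then show c: "card {k \<in> vecs n. \<not> ind3 t i k} = 4" using eq by simp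
  then show "card {k \<in> vecs n. ind3 t i k} = 2 ^ n - 4"
    using card_filter_not[of n "ind3 t i"] by simp
qed

section \<open>Recursion and residues of \<open>omega_count\<close>\<close>

definition omega_count :: "bool list \<Rightarrow> bool list \<Rightarrow> nat" where
  "omega_count t i = card {k \<in> vecs (length t). omega t i k}"

lemma omega_imp_ind3: "omega t i k \<Longrightarrow> ind3 t i k"
  by (induction t i k rule: omega.induct) (auto simp: ind3_def ind2_def split: if_splits)

lemma omega_count_le:
  assumes "length t = n" "length i = n" "ind2 t i"
  shows "omega_count t i \<le> 2 ^ n - 4"
proof -
  have "omega_count t i \<le> card {k \<in> vecs n. ind3 t i k}"
    unfolding omega_count_def using assms omega_imp_ind3 by (intro card_mono) auto
  then show ?thesis using card_ind3(1)[OF assms] by simp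
qed

lemma omega_count_dependent: "\<not> ind2 t i \<Longrightarrow> omega_count t i = 0"
  unfolding omega_count_def by (auto simp: card_eq_0_iff dest!: omega_imp_ind3) (auto simp: ind3_def)

text \<open>With dependent tails \<open>omega\<close> starts afresh and accepts every independent
  vector, so the bound of \<open>omega_count_le\<close> is attained.\<close>

lemma omega_count_new:
  assumes "length t = n" "length i = n" "\<not> ind2 t i" "ind2 (a # t) (b # i)"
  shows "omega_count (a # t) (b # i) = 2 ^ Suc n - 4"
proof -
  have "{k \<in> vecs (length (a # t)). omega (a # t) (b # i) k}
      = {k \<in> vecs (Suc n). ind3 (a # t) (b # i) k}"
    using assms by (auto simp: ind3_def[of t i] length_Suc_conv)
  then show ?thesis
    using assms card_ind3(1)[of "a # t" "Suc n" "b # i"] by (simp add: omega_count_def)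
qed

text \<open>A vector k independent of the tails has two extensions, both with value
  \<open>a \<noteq> omega t i k\<close>. Each of the four k in the span of the tails has exactly one
  extension outside the new span, and these make up the summand 4.\<close>

lemma omega_count_Cons:
  assumes "length t = n" "length i = n" "ind2 t i"
  shows "omega_count (a # t) (b # i) =
     2 * (if a then 2 ^ n - 4 - omega_count t i else omega_count t i) + 4"
proof -
  let ?I = "{k \<in> vecs n. ind3 t i k}" and ?D = "{k \<in> vecs n. \<not> ind3 t i k}"
  let ?f = "\<lambda>k. of_bool (omega (a # t) (b # i) (False # k)) + of_bool (omega (a # t) (b # i) (True # k)) :: nat"
  have "omega_count (a # t) (b # i) = (\<Sum>k\<in>vecs n. ?f k)"
    using assms by (simp only: omega_count_def card_filter_sum sum_vecs_Suc finite_vecs list.size add_0_right add_Suc_right)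
  also have "\<dots> = sum ?f ?I + sum ?f ?D"
    by (subst sum.union_disjoint[symmetric]) (auto intro!: sum.cong)
  also have "sum ?f ?D = sum (\<lambda>_. 1) ?D"
  proof (rule sum.cong)
    fix k assume k: "k \<in> ?D"
    then have "\<not> nonzero k \<or> k = t \<or> k = i \<or> k = t \<triangle> i"
      using assms by (auto simp: ind3_def)
    then show "?f k = 1"
      using k assms by (auto simp: ind3_def ind2_def vadd_zero zero_unique)
  qed simp
  also have "\<dots> = 4" using card_ind3(2)[OF assms] by simp
  also have "sum ?f ?I = (\<Sum>k\<in>?I. 2 * of_bool (a \<noteq> omega t i k))"
    by (intro sum.cong) auto
  also have "\<dots> = 2 * card {k \<in> ?I. a \<noteq> omega t i k}"
    by (subst card_filter_sum) (simp_all add: sum_distrib_left)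
  also have "card {k \<in> ?I. a \<noteq> omega t i k} =
      (if a then 2 ^ n - 4 - omega_count t i else omega_count t i)"
  proof (cases a)
    case True
    have "{k \<in> ?I. a \<noteq> omega t i k} = ?I - {k \<in> vecs n. omega t i k}"
      using True by auto
    moreover have "{k \<in> vecs n. omega t i k} \<subseteq> ?I" using omega_imp_ind3 by auto
    ultimately show ?thesis
      using True assms card_ind3(1)[OF assms] card_Diff_subset[of "{k \<in> vecs n. omega t i k}" ?I]
      by (simp add: omega_count_def)
  next
    case False
    then have "{k \<in> ?I. a \<noteq> omega t i k} = {k \<in> vecs n. omega t i k}"
      using omega_imp_ind3 by auto
    then show ?thesis using False assms by (simp add: omega_count_def)
  qed
  finally show ?thesis .
qed

lemma four_dvd_power: "2 \<le> n \<Longrightarrow> (4::nat) dvd 2 ^ n"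
  using le_imp_power_dvd[of 2 n "2::nat"] by simp

lemma eight_dvd_power: "3 \<le> n \<Longrightarrow> (8::nat) dvd 2 ^ n"
  using le_imp_power_dvd[of 3 n "2::nat"] by simp

lemma ind2_length:
  assumes "length t = n" "length i = n" "ind2 t i"
  shows "2 \<le> n"
proof (rule ccontr)
  assume "\<not> 2 \<le> n"
  then have "n = 0 \<or> n = Suc 0" by auto
  then show False using assms by (auto simp: ind2_def length_Suc_conv)
qed

lemma four_dvd_omega_count:
  "2 \<le> n \<Longrightarrow> length t = n \<Longrightarrow> length i = n \<Longrightarrow> 4 dvd omega_count t i"
proof (induction n arbitrary: t i)
  case (Suc n)
  obtain a t' b i' where [simp]: "t = a # t'" "i = b # i'" "length t' = n" "length i' = n"
    using Suc.prems by (metis length_Suc_conv)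
  consider "\<not> ind2 t i" | "ind2 t i" "\<not> ind2 t' i'" | "ind2 t' i'" by blast
  then show ?case
  proof cases
    case 1
    then show ?thesis by (simp add: omega_count_dependent)
  next
    case 2
    then show ?thesis
      using omega_count_new[of t' n i' a b] four_dvd_power[OF Suc.prems(1)] by (simp add: dvd_diff_nat)
  next
    case 3
    then have "2 \<le> n" by (intro ind2_length[of t' _ i']) simp_all
    then have "4 dvd omega_count t' i'" "(4::nat) dvd 2 ^ n - 4"
      using Suc.IH four_dvd_power by (simp_all add: dvd_diff_nat)
    then have "4 dvd (if a then 2 ^ n - 4 - omega_count t' i' else omega_count t' i')"
      by (simp only: dvd_diff_nat split: if_split) simp
    then show ?thesis using omega_count_Cons[of t' n i' a b] 3
      by (simp only: \<open>t = _\<close> \<open>i = _\<close> \<open>length t' = n\<close> \<open>length i' = n\<close>) (intro dvd_add dvd_mult, auto)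
  qed
qed simp

text \<open>The recursion doubles a multiple of 4 and adds 4; a pair that has only just become
  independent has 2^n - 4. Both are 4 modulo 8. This residue later decides which term of
  \<open>pair_count_Suc\<close> survives.\<close>

lemma omega_count_mod_8:
  assumes "3 \<le> n" "length t = n" "length i = n" "ind2 t i"
  shows "omega_count t i mod 8 = 4"
proof -
  obtain m where n: "n = Suc m" "2 \<le> m" using assms(1) by (cases n) auto
  obtain a t' b i' where [simp]: "t = a # t'" "i = b # i'" "length t' = m" "length i' = m"
    using assms n by (metis length_Suc_conv)
  show ?thesis
  proof (cases "ind2 t' i'")
    case True
    then have "4 dvd omega_count t' i'" "(4::nat) dvd 2 ^ m - 4"
      using n four_dvd_omega_count[of m] four_dvd_power by (simp_all add: dvd_diff_nat)
    then have "4 dvd (if a then 2 ^ m - 4 - omega_count t' i' else omega_count t' i')"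
      by (simp only: dvd_diff_nat split: if_split) simp
    then obtain q where "(if a then 2 ^ m - 4 - omega_count t' i' else omega_count t' i') = 4 * q"
      by (elim dvdE)
    then show ?thesis using omega_count_Cons[of t' m i' a b] True by simp
  next
    case False
    obtain q :: nat where q: "2 ^ n = 8 * q" using eight_dvd_power[OF assms(1)] by blast
    moreover have "q > 0" using q by (cases q) auto
    ultimately have "((2::nat) ^ n - 4) mod 8 = 4"
      by (cases q) auto
    then show ?thesis using omega_count_new[of t' m i' a b] False assms(4) n by simp
  qed
qed

section \<open>Pair counts and the parameters they reveal\<close>

definition pair_count :: "(nat \<Rightarrow> bool) \<Rightarrow> nat \<Rightarrow> nat \<Rightarrow> bool \<Rightarrow> nat" where
  "pair_count g n m c = (\<Sum>t\<in>vecs n. \<Sum>i\<in>vecs n.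
     of_bool (ind2 t i \<and> omega_count t i = m \<and> chi g t = c))"

lemma pair_count_eq_0:
  assumes "3 \<le> n" "m mod 8 \<noteq> 4"
  shows "pair_count g n m c = 0"
proof -
  have "\<not> (ind2 t i \<and> omega_count t i = m \<and> chi g t = c)" if "length t = n" "length i = n" for t i
    using omega_count_mod_8[OF assms(1) that] assms(2) by auto
  then show ?thesis unfolding pair_count_def by (intro sum.neutral ballI) simp
qed

text \<open>The first term collects the extensions of \<open>t\<close> by False, the second those by
  True, which complement the count in 2^n - 4 and multiply the character by the new parameter; the
  factors 2 come from the head of \<open>i\<close>. The strict bound keeps out pairs with dependent
  tails, whose count belongs to m = 2^n - 4.\<close>

lemma pair_count_Suc:
  assumes "m < 2 ^ n - 4"
  shows "pair_count g (Suc n) (2 * m + 4) c =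
    2 * pair_count g n m c + 2 * pair_count g n (2 ^ n - 4 - m) (c = g n)"
proof -
  let ?F = "\<lambda>t i. of_bool (ind2 t i \<and> omega_count t i = 2 * m + 4 \<and> chi g t = c) :: nat"
  have "?F (False # t) (False # i) + ?F (False # t) (True # i) + (?F (True # t) (False # i) + ?F (True # t) (True # i))
     = 2 * of_bool (ind2 t i \<and> omega_count t i = m \<and> chi g t = c)
     + 2 * of_bool (ind2 t i \<and> omega_count t i = 2 ^ n - 4 - m \<and> chi g t = (c = g n))" (is "?L = ?R")
    if [simp]: "length t = n" "length i = n" for t i
  proof (cases "ind2 t i")
    case True
    then have 1: "ind2 (a # t) (b # i)" for a b by (auto simp: ind2_def)
    \<comment> \<open>Both numbers are at most 2^n - 4, so truncated subtraction is an involution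
      here.\<close>
    have 2: "2 ^ n - 4 - omega_count t i = m \<longleftrightarrow> omega_count t i = 2 ^ n - 4 - m"
      using omega_count_le[OF that True] assms by auto
    have "?F (a # t) (b # i) = of_bool (omega_count t i = (if a then 2 ^ n - 4 - m else m) \<and>
        chi g t = (if a then c = g n else c))" for a b
    proof -
      have "omega_count (a # t) (b # i) = 2 * m + 4 \<longleftrightarrow> omega_count t i = (if a then 2 ^ n - 4 - m else m)"
        unfolding omega_count_Cons[OF that True] using 2 by (cases a) simp_all
      moreover have "chi g (a # t) = c \<longleftrightarrow> chi g t = (if a then c = g n else c)"
        by (cases a; cases c; cases "g n") simp_all
      ultimately show ?thesis using 1 by simp
    qed
    then show ?thesis using True by (simp only: if_True if_False simp_thms mult_2)
  next
    case False
    have "omega_count (a # t) (b # i) \<noteq> 2 * m + 4" if "ind2 (a # t) (b # i)" for a b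
      using omega_count_new[of t n i a b] False that assms by simp
    then have "?F (a # t) (b # i) = 0" for a b by (simp only: of_bool_eq_0_iff) blast
    then show ?thesis using False by (simp only: simp_thms of_bool_eq add_0_right mult_0_right)
  qed
  note pointwise = this
  have "pair_count g (Suc n) (2 * m + 4) c = (\<Sum>t\<in>vecs n. \<Sum>i\<in>vecs n.
      ?F (False # t) (False # i) + ?F (False # t) (True # i) + (?F (True # t) (False # i) + ?F (True # t) (True # i)))"
    by (simp only: pair_count_def sum_vecs_Suc sum.distrib)
  also have "\<dots> = (\<Sum>t\<in>vecs n. \<Sum>i\<in>vecs n. 2 * of_bool (ind2 t i \<and> omega_count t i = m \<and> chi g t = c)
     + 2 * of_bool (ind2 t i \<and> omega_count t i = 2 ^ n - 4 - m \<and> chi g t = (c = g n)))"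
    by (intro sum.cong refl pointwise) simp_all
  finally show ?thesis
    by (simp only: pair_count_def sum.distrib sum_distrib_left)
qed

text \<open>The character is trivial exactly when the three parameters are all -1; otherwise its
  kernel has index 2, and the zero vector is removed from it.\<close>

lemma card_chi_3:
  "card {t \<in> vecs 3. nonzero t \<and> chi g t = c} =
    (if g 0 \<and> g 1 \<and> g 2 then if c then 0 else 7 else if c then 4 else 3)"
proof -
  have "card {t \<in> vecs 3. nonzero t \<and> chi g t = c} =
      (\<Sum>t\<in>vecs (Suc (Suc (Suc 0))). of_bool (nonzero t \<and> chi g t = c))"
    by (simp only: card_filter_sum finite_vecs numeral_3_eq_3)
  then show ?thesis
    unfolding sum_vecs_Suc vecs_0
    by (cases c; cases "g 0"; cases "g (Suc 0)"; cases "g 2") (simp_all add: numeral_2_eq_2)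
qed

text \<open>For n = 3 an independent pair has a count that is at most 4 and is 4 modulo 8, hence
  equal to 4. Each nonzero \<open>t\<close> has six independent partners.\<close>

lemma pair_count_3:
  "pair_count g 3 4 c =
    (if g 0 \<and> g 1 \<and> g 2 then if c then 0 else 42 else if c then 24 else 18)"
proof -
  have 4: "omega_count t i = 4" if l: "length t = 3" "length i = 3" and i: "ind2 t i" for t i
  proof -
    have "omega_count t i \<le> 4" "omega_count t i mod 8 = 4"
      using omega_count_le[OF l i] omega_count_mod_8[OF _ l i] by simp_all
    then show ?thesis by presburger
  qed
  have "(\<Sum>i\<in>vecs 3. of_bool (ind2 t i \<and> omega_count t i = 4 \<and> chi g t = c)) =
      (6 * of_bool (nonzero t \<and> chi g t = c) :: nat)" (is "?L = _") if t: "t \<in> vecs 3" for t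
  proof -
    have "?L = (\<Sum>i\<in>vecs 3. of_bool (nonzero t \<and> chi g t = c) * of_bool (nonzero i \<and> i \<noteq> t))"
      using 4 t by (intro sum.cong) (auto simp: ind2_def)
    also have "\<dots> = of_bool (nonzero t \<and> chi g t = c) * card {i \<in> vecs 3. nonzero i \<and> i \<noteq> t}"
      by (simp only: card_filter_sum finite_vecs sum_distrib_left)
    also have "card {i \<in> vecs 3. nonzero i \<and> i \<noteq> t} = 6" if "nonzero t"
    proof -
      have "{i \<in> vecs 3. nonzero i \<and> i \<noteq> t} = {i \<in> vecs 3. nonzero i} - {t}" by auto
      then show ?thesis using t that card_nonzero[of 3] by simp
    qed
    ultimately show ?thesis by auto
  qed
  then have "pair_count g 3 4 c = 6 * card {t \<in> vecs 3. nonzero t \<and> chi g t = c}"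
    by (simp only: pair_count_def card_filter_sum finite_vecs sum_distrib_left cong: sum.cong)
  then show ?thesis unfolding card_chi_3 by simp
qed

text \<open>
  The counts at this value are never balanced, so they can be cancelled to read off one more
  parameter at each doubling.
\<close>

definition key_value :: "nat \<Rightarrow> nat" where
  "key_value n = 2 ^ (n - 1) - 4"

text \<open>The map m to 2 * m + 4 of \<open>pair_count_Suc\<close> carries one key value to the
  next, while the complement of a key value is a power of 2 divisible by 8. So the value suits
  \<open>pair_count_step\<close> and its complement suits \<open>pair_count_step'\<close>.\<close>

lemma key_value_props:
  assumes "4 \<le> n"
  shows "key_value (Suc n) = 2 * key_value n + 4" "key_value n mod 8 = 4" "key_value n < 2 ^ n - 4"
    "2 ^ n - 4 - key_value n = 2 ^ (n - 1)" "(2::nat) ^ (n - 1) mod 8 = 0" "(2::nat) ^ (n - 1) < 2 ^ n - 4"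
proof -
  obtain m where m: "n = 4 + m" using assms le_Suc_ex by blast
  define q where "q = (2::nat) ^ m"
  have "q > 0" by (simp add: q_def)
  have "(2::nat) ^ (n - 1) = 8 * q" "(2::nat) ^ n = 16 * q" "(2::nat) ^ (Suc n - 1) = 16 * q"
    by (simp_all add: q_def m power_add)
  note key = this
  obtain p where "q = Suc p" using \<open>q > 0\<close> by (cases q) auto
  then show "key_value (Suc n) = 2 * key_value n + 4" "key_value n mod 8 = 4" "key_value n < 2 ^ n - 4"
    "2 ^ n - 4 - key_value n = 2 ^ (n - 1)" "(2::nat) ^ (n - 1) mod 8 = 0" "(2::nat) ^ (n - 1) < 2 ^ n - 4"
    unfolding key_value_def key by simp_all
qed

text \<open>The complement 2^n - 4 - m is 0 modulo 8, a value that no independent pair attains, so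
  the second term of the recursion vanishes.\<close>

lemma pair_count_step:
  assumes "3 \<le> n" "m mod 8 = 4" "m < 2 ^ n - 4"
  shows "pair_count g (Suc n) (2 * m + 4) c = 2 * pair_count g n m c"
proof -
  have "m = 8 * (m div 8) + 4" using assms(2) div_mult_mod_eq[of m 8] by simp
  then have "8 * q - 4 - m = 8 * (q - 1 - m div 8)" for q by arith
  then have "(8 * q - 4 - m) mod 8 \<noteq> 4" for q by simp
  then have "(2 ^ n - 4 - m) mod 8 \<noteq> 4"
    using eight_dvd_power[OF assms(1)] by (metis dvdE)
  then have "pair_count g n (2 ^ n - 4 - m) (c = g n) = 0"
    by (rule pair_count_eq_0[OF assms(1)])
  then show ?thesis by (simp only: pair_count_Suc[OF assms(3)] mult_0_right add_0_right)
qed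

text \<open>Here it is m that is never attained. The surviving term has its character value twisted
  by \<open>g n\<close>, which makes this parameter visible.\<close>

lemma pair_count_step':
  assumes "3 \<le> n" "m mod 8 = 0" "m < 2 ^ n - 4"
  shows "pair_count g (Suc n) (2 * m + 4) c = 2 * pair_count g n (2 ^ n - 4 - m) (c = g n)"
proof -
  have "pair_count g n m c = 0"
    by (rule pair_count_eq_0[OF assms(1)]) (subst assms(2), simp)
  then show ?thesis by (simp only: pair_count_Suc[OF assms(3)] mult_0_right add_0)
qed

lemma pair_count_4: "pair_count g 4 4 c = 2 * pair_count g 3 4 (c = g 3)"
proof -
  \<comment> \<open>The value 4 arises from m = 0, whose complement in 2^3 - 4 is again 4.\<close>
  have "pair_count g (Suc 3) (2 * 0 + 4) c = 2 * pair_count g 3 (2 ^ 3 - 4 - 0) (c = g 3)"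
    by (rule pair_count_step') simp_all
  moreover have "Suc 3 = 4" "2 * 0 + 4 = (4::nat)" "2 ^ 3 - 4 - 0 = (4::nat)" by simp_all
  ultimately show ?thesis by (simp only:)
qed

text \<open>For n = 4 the two counts are 84 and 0, or 48 and 36, in some order; every further
  doubling multiplies both by 2.\<close>

lemma pair_count_key_neq:
  "4 \<le> n \<Longrightarrow> pair_count g n (key_value n) True \<noteq> pair_count g n (key_value n) False"
proof (induction n rule: dec_induct)
  case base
  show ?case
    by (cases "g 3") (simp_all add: key_value_def pair_count_4 pair_count_3)
next
  case (step n)
  note key = key_value_props[OF step.hyps(1)]
  have "3 \<le> n" using step.hyps by simp
  then have "pair_count g (Suc n) (key_value (Suc n)) c = 2 * pair_count g n (key_value n) c" for c
    unfolding key(1) by (rule pair_count_step) (rule key)+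
  with step.IH show ?case by simp
qed

text \<open>\<open>pair_count_step\<close> recovers the counts at n from those at Suc n. The value 2
  * 2^(n-1) + 4 reveals \<open>g n\<close>: its count is twice the key value count at n, at a
  character value chosen by \<open>g n\<close>, and the two candidates differ.\<close>

lemma pair_count_determines:
  assumes "4 \<le> n"
    and "\<And>m c. m mod 8 = 4 \<Longrightarrow> m < 2 ^ n - 4 \<Longrightarrow> pair_count g n m c = pair_count h n m c"
  shows "(g 0 \<and> g 1 \<and> g 2 \<longleftrightarrow> h 0 \<and> h 1 \<and> h 2) \<and> (\<forall>k. 3 \<le> k \<and> k < n \<longrightarrow> g k = h k)"
  using assms
proof (induction n rule: dec_induct)
  case base
  have "pair_count g 4 4 c = pair_count h 4 4 c" for c using base by simp
  \<comment> \<open>The count for True is 0, 84, 48 or 36 in the four combinations, so the base case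
    separates them.\<close>
  from this[of True] this[of False]
  have "(g 0 \<and> g 1 \<and> g 2 \<longleftrightarrow> h 0 \<and> h 1 \<and> h 2) \<and> g 3 = h 3"
    by (simp add: pair_count_4 pair_count_3 split: if_splits; blast)
  moreover have "3 \<le> k \<and> k < 4 \<longleftrightarrow> k = 3" for k :: nat by auto
  ultimately show ?case by simp
next
  case (step n)
  have eq: "pair_count g n m c = pair_count h n m c" if "m mod 8 = 4" "m < 2 ^ n - 4" for m c
  proof -
    have "(2 * m + 4) mod 8 = 4" using that(1) by presburger
    moreover have "2 * m + 4 < 2 ^ Suc n - 4" using that(2) by simp
    ultimately show ?thesis
      using step.prems[of "2 * m + 4" c] that step.hyps by (simp add: pair_count_step)
  qed
  note key = key_value_props[OF step.hyps(1)]
  have 3: "3 \<le> n" using step.hyps by simp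
  have mod_8: "(2 * x + 4) mod 8 = (4::nat)" if "x mod 8 = 0" for x
    using that by presburger
  have "(2 * 2 ^ (n - 1) + 4) mod 8 = (4::nat)" by (rule mod_8[OF key(5)])
  moreover have "2 * 2 ^ (n - 1) + 4 < (2::nat) ^ Suc n - 4" using key(6) by simp
  ultimately have "pair_count g (Suc n) (2 * 2 ^ (n - 1) + 4) True = pair_count h (Suc n) (2 * 2 ^ (n - 1) + 4) True"
    by (rule step.prems)
  moreover have "2 ^ n - 4 - 2 ^ (n - 1) = key_value n" using key(3,4) by linarith
  ultimately have "pair_count g n (key_value n) (True = g n) = pair_count h n (key_value n) (True = h n)"
    using pair_count_step'[OF 3 key(5,6), of g True] pair_count_step'[OF 3 key(5,6), of h True]
    by (simp only: mult_cancel1) simp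
  then have "g n = h n"
    using eq[OF key(2,3)] pair_count_key_neq[OF step.hyps(1), of h] by (cases "g n"; cases "h n") auto
  then show ?case using step.IH[OF eq] by (auto simp: less_Suc_eq)
qed

section \<open>Arithmetic of basis elements\<close>

lemma cd_carrier_SucE:
  assumes "x \<in> cd_carrier (Suc n)"
  obtains a b where "x = Dbl a b" "a \<in> cd_carrier n" "b \<in> cd_carrier n"
  using assms by auto

lemma cd_zero_carrier [simp]: "cd_zero n \<in> cd_carrier n"
  by (induction n) auto

lemma cd_scale_carrier [simp]: "x \<in> cd_carrier n \<Longrightarrow> cd_scale r x \<in> cd_carrier n"
  by (induction n arbitrary: x) auto

lemma cd_conj_carrier [simp]: "x \<in> cd_carrier n \<Longrightarrow> cd_conj x \<in> cd_carrier n"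
  by (induction n arbitrary: x) auto

lemma cd_add_carrier [simp]:
  "x \<in> cd_carrier n \<Longrightarrow> y \<in> cd_carrier n \<Longrightarrow> cd_add x y \<in> cd_carrier n"
  by (induction n arbitrary: x y) (fastforce elim!: cd_carrier_SucE)+

lemma cd_mult_carrier [simp]:
  "x \<in> cd_carrier n \<Longrightarrow> y \<in> cd_carrier n \<Longrightarrow> cd_mult \<gamma> n x y \<in> cd_carrier n"
proof (induction n arbitrary: x y)
  case (Suc n)
  then show ?case by (elim cd_carrier_SucE) simp
qed auto

lemma cd_add_zero [simp]:
  "x \<in> cd_carrier n \<Longrightarrow> cd_add x (cd_zero n) = x"
  "x \<in> cd_carrier n \<Longrightarrow> cd_add (cd_zero n) x = x"
  by (induction n arbitrary: x) auto

lemma cd_scale_zero [simp]: "cd_scale r (cd_zero n) = cd_zero n"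
  by (induction n) auto

lemma cd_scale_0: "x \<in> cd_carrier n \<Longrightarrow> cd_scale 0 x = cd_zero n"
  by (induction n arbitrary: x) auto

lemma cd_scale_1 [simp]: "cd_scale 1 x = x"
  by (induction x) auto

lemma cd_scale_scale [simp]: "cd_scale r (cd_scale s x) = cd_scale (r * s) x"
  by (induction x) auto

lemma cd_add_scale: "cd_add (cd_scale r x) (cd_scale s x) = cd_scale (r + s) x"
  by (induction x) (auto simp: algebra_simps)

lemma cd_scale_add:
  "x \<in> cd_carrier n \<Longrightarrow> y \<in> cd_carrier n \<Longrightarrow> cd_scale r (cd_add x y) = cd_add (cd_scale r x) (cd_scale r y)"
proof (induction n arbitrary: x y)
  case (Suc n)
  then show ?case by (elim cd_carrier_SucE) simp
qed (auto simp: algebra_simps)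

lemma cd_add_eq_0D:
  "x \<in> cd_carrier n \<Longrightarrow> y \<in> cd_carrier n \<Longrightarrow> cd_add x y = cd_zero n \<Longrightarrow> y = cd_neg x"
proof (induction n arbitrary: x y)
  case (Suc n)
  then show ?case by (elim cd_carrier_SucE) simp
qed auto

lemma cd_conj_scale: "cd_conj (cd_scale r x) = cd_scale r (cd_conj x)"
  by (induction x) (auto simp: mult.commute)

lemma cd_conj_zero [simp]: "cd_conj (cd_zero n) = cd_zero n"
  by (induction n) auto

lemma cd_mult_zero [simp]:
  "x \<in> cd_carrier n \<Longrightarrow> cd_mult \<gamma> n x (cd_zero n) = cd_zero n"
  "x \<in> cd_carrier n \<Longrightarrow> cd_mult \<gamma> n (cd_zero n) x = cd_zero n"
  by (induction n arbitrary: x) auto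

lemma cd_mult_scale:
  "x \<in> cd_carrier n \<Longrightarrow> y \<in> cd_carrier n \<Longrightarrow>
     cd_mult \<gamma> n (cd_scale r x) y = cd_scale r (cd_mult \<gamma> n x y) \<and>
     cd_mult \<gamma> n x (cd_scale r y) = cd_scale r (cd_mult \<gamma> n x y)"
proof (induction n arbitrary: x y)
  case (Suc n)
  then show ?case
    by (elim cd_carrier_SucE) (simp add: cd_scale_add[where n = n] cd_conj_scale mult.commute)
qed auto

lemma cd_mult_scale_left [simp]:
  "x \<in> cd_carrier n \<Longrightarrow> y \<in> cd_carrier n \<Longrightarrow> cd_mult \<gamma> n (cd_scale r x) y = cd_scale r (cd_mult \<gamma> n x y)"
  and cd_mult_scale_right [simp]:
  "x \<in> cd_carrier n \<Longrightarrow> y \<in> cd_carrier n \<Longrightarrow> cd_mult \<gamma> n x (cd_scale r y) = cd_scale r (cd_mult \<gamma> n x y)"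
  using cd_mult_scale by blast+

section \<open>Basis elements indexed by bit vectors\<close>

fun unit_vec :: "bool list \<Rightarrow> cd" where
  "unit_vec [] = Scalar 1"
| "unit_vec (a # x) =
     (if a then Dbl (cd_zero (length x)) (unit_vec x) else Dbl (unit_vec x) (cd_zero (length x)))"

lemma unit_vec_carrier [simp]: "length x = n \<Longrightarrow> unit_vec x \<in> cd_carrier n"
  by (induction x arbitrary: n) auto

lemma unit_vec_neq_zero: "length x = n \<Longrightarrow> unit_vec x \<noteq> cd_zero n"
  by (induction x arbitrary: n) auto

lemma cd_basis_0: "cd_basis n 0 = unit_vec (replicate n False)"
  by (induction n) auto

text \<open>The head of the bit vector is the leading binary digit of the index.\<close>

lemma cd_basis_set_eq: "cd_basis_set n = unit_vec ` vecs n"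
proof (induction n)
  case (Suc n)
  have split: "{..<2 ^ Suc n} = {..<2 ^ n} \<union> (\<lambda>j. j + 2 ^ n) ` {..<(2::nat) ^ n}"
    unfolding lessThan_atLeast0 image_add_atLeastLessThan' by auto
  have "cd_basis (Suc n) ` {..<2 ^ n} = (\<lambda>a. Dbl a (cd_zero n)) ` cd_basis_set n"
    unfolding cd_basis_set_def image_image by (intro image_cong) simp_all
  moreover have "cd_basis (Suc n) ` (\<lambda>j. j + 2 ^ n) ` {..<2 ^ n} = Dbl (cd_zero n) ` cd_basis_set n"
    unfolding cd_basis_set_def image_image by (intro image_cong) simp_all
  moreover have "unit_vec ` Cons False ` vecs n = (\<lambda>a. Dbl a (cd_zero n)) ` unit_vec ` vecs n"
    "unit_vec ` Cons True ` vecs n = Dbl (cd_zero n) ` unit_vec ` vecs n"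
    unfolding image_image by (intro image_cong; simp)+
  ultimately show ?case
    by (simp only: cd_basis_set_def[of "Suc n"] split image_Un vecs_Suc Suc.IH)
qed (auto simp: cd_basis_set_def)

definition sign :: "bool \<Rightarrow> real" where
  "sign b = (if b then - 1 else 1)"

lemma sign_simps [simp]:
  "sign False = 1" "sign True = - 1" "sign b * sign c = sign (b \<noteq> c)" "sign b \<noteq> 0"
  "sign b * (sign c * x) = sign (b \<noteq> c) * x"
  by (auto simp: sign_def)

lemma sign_add_eq_0: "sign b + sign c = 0 \<longleftrightarrow> b \<noteq> c"
  by (auto simp: sign_def)

lemma sign_eq_iff [simp]: "sign b = sign c \<longleftrightarrow> b = c" "sign b = 1 \<longleftrightarrow> \<not> b"
  by (auto simp: sign_def)

lemma cd_conj_unit_vec: "cd_conj (unit_vec x) = cd_scale (sign (nonzero x)) (unit_vec x)"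
  by (induction x) auto

lemma cd_mult_unit_vec:
  assumes "\<forall>k<n. \<gamma> k = sign (g k)" "length x = n" "length y = n"
  shows "cd_mult \<gamma> n (unit_vec x) (unit_vec y) = cd_scale (sign (sgn_mult g x y)) (unit_vec (x \<triangle> y))"
  using assms
proof (induction n arbitrary: x y)
  case (Suc n)
  obtain a x' b y' where [simp]: "x = a # x'" "y = b # y'" and l [simp]: "length x' = n" "length y' = n"
    using Suc.prems by (metis length_Suc_conv)
  have *: "cd_mult \<gamma> n (unit_vec u) (unit_vec v) = cd_scale (sign (sgn_mult g u v)) (unit_vec (u \<triangle> v))"
    if "length u = n" "length v = n" for u v
    using Suc.IH[OF _ that] Suc.prems(1) by simp
  have "\<gamma> n = sign (g n)" using Suc.prems(1) by simp
  then show ?case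
    by (cases a; cases b)
      (simp_all add: cd_conj_unit_vec vadd_commute[of y' x'] *[OF l] *[OF l(2) l(1)] eq_commute[of "nonzero y'"])
qed simp

lemma unit_vec_eq_scale:
  "length x = length y \<Longrightarrow> unit_vec y = cd_scale r (unit_vec x) \<Longrightarrow> x = y \<and> r = 1"
proof (induction x y rule: list_induct2)
  case (Cons a x b y)
  then show ?case
    using unit_vec_neq_zero[of x "length x"] unit_vec_neq_zero[of y "length y"] by (auto split: if_splits)
qed simp

lemma cd_add_unit_vec_eq_0:
  assumes "length x = n" "length y = n"
  shows "cd_add (cd_scale (sign b) (unit_vec x)) (cd_scale (sign c) (unit_vec y)) = cd_zero n
     \<longleftrightarrow> x = y \<and> b \<noteq> c"
proof
  assume "cd_add (cd_scale (sign b) (unit_vec x)) (cd_scale (sign c) (unit_vec y)) = cd_zero n"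
  then have "cd_scale (sign c) (unit_vec y) = cd_neg (cd_scale (sign b) (unit_vec x))"
    using assms by (intro cd_add_eq_0D[of _ n]) simp_all
  then have "cd_scale (sign c) (cd_scale (sign c) (unit_vec y)) =
      cd_scale (sign c) (cd_neg (cd_scale (sign b) (unit_vec x)))"
    by simp
  then have "unit_vec y = cd_scale (- sign (b \<noteq> c)) (unit_vec x)"
    by (simp add: eq_commute[of c b])
  then show "x = y \<and> b \<noteq> c"
    using unit_vec_eq_scale[of x y "- sign (b \<noteq> c)"] assms by (simp add: sign_def split: if_splits)
next
  assume "x = y \<and> b \<noteq> c"
  then show "cd_add (cd_scale (sign b) (unit_vec x)) (cd_scale (sign c) (unit_vec y)) = cd_zero n"
    using assms sign_add_eq_0[of b c] by (simp add: cd_add_scale cd_scale_0)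
qed

text \<open>The second component is recorded by the sum \<open>t\<close> of both indices instead of
  its own index, because \<open>t\<close> is the same for adjacent vertices.\<close>

definition vertex_vec :: "bool list \<Rightarrow> bool list \<Rightarrow> bool \<Rightarrow> cd" where
  "vertex_vec t i s = Dbl (unit_vec i) (cd_scale (sign s) (unit_vec (i \<triangle> t)))"

section \<open>Degrees\<close>

lemma sign_xor:
  "sign (\<not> a) = - sign a" "sign (a = b) = - sign a * sign b"
  by (auto simp: sign_def)

lemma vadd_assoc: "x \<triangle> y \<triangle> z = x \<triangle> (y \<triangle> z)"
proof (induction x y arbitrary: z rule: vadd.induct)
  case (1 a x b y)
  then show ?case by (cases z) auto
qed auto

lemma vadd_left_commute: "x \<triangle> (y \<triangle> z) = y \<triangle> (x \<triangle> z)"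
  by (metis vadd_assoc vadd_commute)

text \<open>This makes the two one-sided products of vertices vanish together. For distinct
  \<open>i\<close> and \<open>k\<close> the sign of e_i e_k flips, and so does that of the last
  product with its conjugation: either its factors anticommute, or exactly one is the unit and the
  conjugation sign changes.\<close>

lemma theta_commute:
  assumes [simp]: "length t = n" "length i = n" "length k = n" and "nonzero i" "nonzero k"
  shows "theta g t k i = theta g t i k"
proof (cases "k = i")
  case False
  then have "\<not> (\<not> nonzero (i \<triangle> t) \<and> \<not> nonzero (k \<triangle> t))" by auto
  then show ?thesis
    using False assms(4,5) sgn_mult_commute[of i k g] sgn_mult_commute[of "k \<triangle> t" "i \<triangle> t" g]
    unfolding theta_def
    by (cases "nonzero (i \<triangle> t)"; cases "nonzero (k \<triangle> t)"; simp del: nonzero_vadd) (argo+)?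
qed simp

definition degree_at :: "(nat \<Rightarrow> bool) \<Rightarrow> nat \<Rightarrow> bool list \<Rightarrow> bool list \<Rightarrow> nat" where
  "degree_at g n t i = (if chi g t = g n then 2 ^ n - 2 - omega_count t i else omega_count t i)"

text \<open>If \<open>chi g t = g n\<close>, the admissible k are those with \<open>omega\<close>
  False, except the zero vector and \<open>i\<close>, which explains the 2. Otherwise
  \<open>omega\<close> must be True, which already excludes these two.\<close>

lemma card_neighbours:
  assumes [simp]: "length t = n" "length i = n" and "nonzero i"
  shows "card {k \<in> vecs n. nonzero k \<and> k \<noteq> i \<and> (chi g t \<noteq> omega t i k) = g n} = degree_at g n t i"
proof (cases "chi g t = g n")
  case True
  let ?z = "replicate n False"
  have *: "\<not> omega t i ?z" "\<not> omega t i i"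
    using omega_imp_ind3[of t i ?z] omega_imp_ind3[of t i i] by (auto simp: ind3_def)
  have zi: "?z \<noteq> i" using assms(3) by auto
  have nz: "nonzero k \<longleftrightarrow> k \<noteq> ?z" if "length k = n" for k
    using zero_vec[OF that] by blast
  have "{k \<in> vecs n. nonzero k \<and> k \<noteq> i \<and> (chi g t \<noteq> omega t i k) = g n}
      = {k \<in> vecs n. \<not> omega t i k} - {?z, i}"
    using True by (auto simp: nz)
  moreover have "card ({k \<in> vecs n. \<not> omega t i k} - {?z, i}) = card {k \<in> vecs n. \<not> omega t i k} - 2"
    using * zi by (subst card_Diff_subset) auto
  ultimately show ?thesis
    using True card_filter_not[of n "omega t i"] by (simp add: degree_at_def omega_count_def)
next
  case False
  have "{k \<in> vecs n. nonzero k \<and> k \<noteq> i \<and> (chi g t \<noteq> omega t i k) = g n} = {k \<in> vecs n. omega t i k}"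
    using False omega_imp_ind3[of t i] by (auto simp: ind3_def)
  then show ?thesis using False by (simp add: degree_at_def omega_count_def)
qed

definition vertex_line :: "bool list \<Rightarrow> bool list \<Rightarrow> bool \<Rightarrow> cd set" where
  "vertex_line t i s = line (vertex_vec t i s)"

lemma vertex_vec_carrier [simp]:
  "length t = n \<Longrightarrow> length i = n \<Longrightarrow> vertex_vec t i s \<in> cd_carrier (Suc n)"
  by (auto simp: vertex_vec_def)

lemma vertex_vec_neq_zero:
  "length i = n \<Longrightarrow> vertex_vec t i s \<noteq> cd_zero (Suc n)"
  by (simp add: vertex_vec_def unit_vec_neq_zero)

text \<open>The first component of a generator has coefficient +1, so proportional generators are
  equal.\<close>

lemma vertex_line_eq_iff:
  assumes [simp]: "length t = n" "length i = n" "length t' = n" "length k = n"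
  shows "vertex_line t i s = vertex_line t' k r \<longleftrightarrow> t = t' \<and> i = k \<and> s = r"
proof
  assume "vertex_line t i s = vertex_line t' k r"
  moreover have "vertex_vec t' k r \<in> vertex_line t' k r"
    unfolding vertex_line_def line_def by (metis cd_scale_1 rangeI)
  ultimately obtain c where c: "vertex_vec t' k r = cd_scale c (vertex_vec t i s)"
    unfolding vertex_line_def line_def by auto
  then have "unit_vec k = cd_scale c (unit_vec i)" by (simp add: vertex_vec_def)
  then have ik: "i = k" "c = 1" using unit_vec_eq_scale[of i k c] by auto
  with c have "cd_scale (sign r) (cd_scale (sign r) (unit_vec (k \<triangle> t'))) =
      cd_scale (sign r) (cd_scale (sign s) (unit_vec (k \<triangle> t)))"
    by (simp add: vertex_vec_def)
  then have "unit_vec (k \<triangle> t') = cd_scale (sign (r \<noteq> s)) (unit_vec (k \<triangle> t))" by simp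
  then have "k \<triangle> t = k \<triangle> t' \<and> sign (r \<noteq> s) = 1"
    by (intro unit_vec_eq_scale) simp_all
  then show "t = t' \<and> i = k \<and> s = r" using ik by auto
qed simp

lemma basis_candidates:
  "{Dbl a b | a b. a \<in> cd_basis_set n - {cd_basis n 0} \<and> b \<in> cd_basis_set n \<union> cd_neg ` cd_basis_set n}
   = {vertex_vec t i s | t i s. t \<in> vecs n \<and> i \<in> vecs n \<and> nonzero i}" (is "?A = ?B")
proof
  have inj: "unit_vec x = unit_vec y \<longleftrightarrow> x = y" if "length x = n" "length y = n" for x y
    using unit_vec_eq_scale[of y x 1] that by auto
  show "?B \<subseteq> ?A"
  proof
    fix u assume "u \<in> ?B"
    then obtain t i s where u: "u = vertex_vec t i s" and l: "length t = n" "length i = n" "nonzero i" by auto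
    then have "unit_vec i \<noteq> cd_basis n 0" using inj by (auto simp: cd_basis_0)
    then show "u \<in> ?A"
      using l u by (cases s) (auto simp: vertex_vec_def cd_basis_set_eq)
  qed
  show "?A \<subseteq> ?B"
  proof
    fix u assume "u \<in> ?A"
    then obtain i j s where u: "u = Dbl (unit_vec i) (cd_scale (sign s) (unit_vec j))"
      and l: "length i = n" "length j = n" and nz: "unit_vec i \<noteq> cd_basis n 0"
      by (fastforce simp: cd_basis_set_eq sign_def)
    then have "nonzero i" using zero_vec[OF l(1)] by (auto simp: cd_basis_0)
    moreover have "u = vertex_vec (i \<triangle> j) i s" using u l by (simp add: vertex_vec_def)
    ultimately show "u \<in> ?B" using l by force
  qed
qed

section \<open>Adjacency and degrees in the graph\<close>

locale sign_params =
  fixes \<gamma> :: "nat \<Rightarrow> real" and g :: "nat \<Rightarrow> bool" and n :: nat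
  assumes params: "k \<le> n \<Longrightarrow> \<gamma> k = sign (g k)"
begin

text \<open>In each component the two basis elements coincide exactly when \<open>t = t'\<close>.
  Cancellation in the second component gives the relation between \<open>s\<close> and
  \<open>r\<close>, and substituting it into the first leaves the condition on
  \<open>theta\<close>.\<close>

lemma vertex_mult_eq_zero:
  assumes [simp]: "length t = n" "length i = n" "length t' = n" "length k = n"
    and nz: "nonzero i" "nonzero k"
  shows "cd_mult \<gamma> (Suc n) (vertex_vec t i s) (vertex_vec t' k r) = cd_zero (Suc n) \<longleftrightarrow>
    t = t' \<and> theta g t i k = (\<not> g n) \<and>
    (s \<noteq> r) = (sgn_mult g (k \<triangle> t) i \<noteq> sgn_mult g (i \<triangle> t) k)"
proof -
  have m: "cd_mult \<gamma> n (unit_vec x) (unit_vec y) = cd_scale (sign (sgn_mult g x y)) (unit_vec (x \<triangle> y))"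
    if "length x = n" "length y = n" for x y
    using params that by (intro cd_mult_unit_vec) auto
  let ?j = "i \<triangle> t" and ?l = "k \<triangle> t'"
  have g: "\<gamma> n = sign (g n)" using params by simp
  have "cd_mult \<gamma> (Suc n) (vertex_vec t i s) (vertex_vec t' k r) =
    Dbl (cd_add (cd_scale (sign (sgn_mult g i k)) (unit_vec (i \<triangle> k)))
          (cd_scale (sign (g n \<noteq> (r \<noteq> (nonzero ?l \<noteq> (s \<noteq> sgn_mult g ?l ?j))))) (unit_vec (?l \<triangle> ?j))))
        (cd_add (cd_scale (sign (r \<noteq> sgn_mult g ?l i)) (unit_vec (?l \<triangle> i)))
          (cd_scale (sign (s \<noteq> (nonzero k \<noteq> sgn_mult g ?j k))) (unit_vec (?j \<triangle> k))))"
    by (simp add: vertex_vec_def cd_conj_scale cd_conj_unit_vec m g sign_xor mult_ac del: sign_simps(3,5))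
  also have "\<dots> = cd_zero (Suc n) \<longleftrightarrow>
      (i \<triangle> k = ?l \<triangle> ?j \<and> sgn_mult g i k \<noteq> (g n \<noteq> (r \<noteq> (nonzero ?l \<noteq> (s \<noteq> sgn_mult g ?l ?j))))) \<and>
      (?l \<triangle> i = ?j \<triangle> k \<and> (r \<noteq> sgn_mult g ?l i) \<noteq> (s \<noteq> (nonzero k \<noteq> sgn_mult g ?j k)))"
    by (simp add: cd_add_unit_vec_eq_0 del: nonzero_vadd)
  also have "i \<triangle> k = ?l \<triangle> ?j \<longleftrightarrow> t = t'"
  proof -
    have "?l \<triangle> ?j = (i \<triangle> k) \<triangle> (t \<triangle> t')"
      by (simp add: vadd_assoc vadd_commute vadd_left_commute)
    then show ?thesis by simp
  qed
  also have "?l \<triangle> i = ?j \<triangle> k \<longleftrightarrow> t = t'"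
  proof -
    have "?l \<triangle> i = (i \<triangle> k) \<triangle> t'" "?j \<triangle> k = (i \<triangle> k) \<triangle> t"
      by (simp_all add: vadd_assoc vadd_commute vadd_left_commute)
    then show ?thesis by auto
  qed
  finally show ?thesis using nz unfolding theta_def by (cases "t = t'"; simp del: nonzero_vadd) argo
qed

text \<open>The sign \<open>r\<close> comes out as a function of the other data, so every admissible
  \<open>k\<close> yields exactly one neighbour.\<close>

lemma orthogonal_vertex_iff:
  assumes [simp]: "length t = n" "length i = n" "length t' = n" "length k = n"
    and nz: "nonzero i" "nonzero k"
  shows "orthogonal_elems (cd_algebra \<gamma> (Suc n)) (vertex_vec t i s) (vertex_vec t' k r) \<longleftrightarrow>
    t = t' \<and> (chi g t \<noteq> omega t i k) = g n \<and>
    r = (s \<noteq> (sgn_mult g (k \<triangle> t) i \<noteq> sgn_mult g (i \<triangle> t) k))"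
proof -
  have "theta g t i k = (\<not> chi g t \<noteq> omega t i k)"
    using nz by (intro theta_eq) simp_all
  then have th: "theta g t i k = (\<not> g n) \<longleftrightarrow> (chi g t \<noteq> omega t i k) = g n" by auto
  have "orthogonal_elems (cd_algebra \<gamma> (Suc n)) (vertex_vec t i s) (vertex_vec t' k r) \<longleftrightarrow>
      cd_mult \<gamma> (Suc n) (vertex_vec t i s) (vertex_vec t' k r) = cd_zero (Suc n) \<and>
      cd_mult \<gamma> (Suc n) (vertex_vec t' k r) (vertex_vec t i s) = cd_zero (Suc n)"
    by (simp add: orthogonal_elems_def cd_algebra_def del: cd_zero.simps)
  also have "\<dots> \<longleftrightarrow> t = t' \<and> theta g t i k = (\<not> g n) \<and>
    (s \<noteq> r) = (sgn_mult g (k \<triangle> t) i \<noteq> sgn_mult g (i \<triangle> t) k)"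
  proof (cases "t = t'")
    case True
    then show ?thesis
      using nz theta_commute[of t n i k g]
      by (simp only: vertex_mult_eq_zero assms) (simp; argo)
  next
    case False
    then show ?thesis using nz by (simp only: vertex_mult_eq_zero assms) simp
  qed
  finally show ?thesis unfolding th by argo
qed

lemma vertex_vec_zero_divisor:
  assumes [simp]: "length t = n" "length i = n" "length k = n" and nz: "nonzero i" "nonzero k"
    and orth: "orthogonal_elems (cd_algebra \<gamma> (Suc n)) (vertex_vec t i s) (vertex_vec t k r)"
  shows "vertex_vec t i s \<in> basis_zero_divisors \<gamma> n"
proof -
  have "vertex_vec t i s \<in> zero_divisors (cd_algebra \<gamma> (Suc n))"
    unfolding zero_divisors_def
    using orth vertex_vec_neq_zero[of i n] vertex_vec_neq_zero[of k n] vertex_vec_carrier[of t n i] vertex_vec_carrier[of t n k]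
    by (auto simp: orthogonal_elems_def cd_algebra_def simp del: cd_zero.simps cd_carrier.simps cd_mult.simps)
  then show ?thesis
    unfolding basis_zero_divisors_def basis_candidates using nz
    by (intro IntI CollectI exI[of _ t] exI[of _ i] exI[of _ s] conjI) simp_all
qed

lemma basis_zero_divisorsE:
  assumes "u \<in> basis_zero_divisors \<gamma> n"
  obtains t i s where "u = vertex_vec t i s" "length t = n" "length i = n" "nonzero i"
  using assms unfolding basis_zero_divisors_def basis_candidates by auto

lemma neighbours_vertex_line:
  assumes [simp]: "length t = n" "length i = n" and nz: "nonzero i"
  shows "{M. (vertex_line t i s, M) \<in> parcs (Gamma_e \<gamma> n)} =
    (\<lambda>k. vertex_line t k (s \<noteq> (sgn_mult g (k \<triangle> t) i \<noteq> sgn_mult g (i \<triangle> t) k))) `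
      {k \<in> vecs n. nonzero k \<and> k \<noteq> i \<and> (chi g t \<noteq> omega t i k) = g n}" (is "?A = ?f ` ?K")
proof
  show "?A \<subseteq> ?f ` ?K"
  proof
    fix M assume "M \<in> ?A"
    then obtain u v where uv: "u \<in> basis_zero_divisors \<gamma> n" "v \<in> basis_zero_divisors \<gamma> n"
      "vertex_line t i s = line u" "M = line v" "line u \<noteq> line v" "orthogonal_elems (cd_algebra \<gamma> (Suc n)) u v"
      by (auto simp: Gamma_e_def)
    obtain t1 i1 s1 where 1: "u = vertex_vec t1 i1 s1" "length t1 = n" "length i1 = n" "nonzero i1"
      using uv(1) by (rule basis_zero_divisorsE)
    obtain t2 k r where 2: "v = vertex_vec t2 k r" "length t2 = n" "length k = n" "nonzero k"
      using uv(2) by (rule basis_zero_divisorsE)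
    have eq: "t1 = t" "i1 = i" "s1 = s"
      using uv(3) 1 vertex_line_eq_iff[of t n i t1 i1 s s1] by (simp_all add: vertex_line_def)
    have o: "t = t2" "(chi g t \<noteq> omega t i k) = g n"
        "r = (s \<noteq> (sgn_mult g (k \<triangle> t) i \<noteq> sgn_mult g (i \<triangle> t) k))"
      using uv(6) orthogonal_vertex_iff[of t i t2 k s r] 1 2 nz unfolding eq by auto
    \<comment> \<open>For \<open>k = i\<close> the two product signs cancel, so \<open>r = s\<close>
      and the lines would coincide.\<close>
    have "k \<noteq> i" using uv(5) o(1,3) unfolding 1 2 eq by auto
    then show "M \<in> ?f ` ?K"
      using o 2 uv(4) by (intro image_eqI[of _ _ k]) (simp_all add: vertex_line_def)
  qed
  show "?f ` ?K \<subseteq> ?A"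
  proof
    fix M assume "M \<in> ?f ` ?K"
    then obtain k where k: "length k = n" "nonzero k" "k \<noteq> i" "(chi g t \<noteq> omega t i k) = g n" "M = ?f k" by auto
    define r where "r = (s \<noteq> (sgn_mult g (k \<triangle> t) i \<noteq> sgn_mult g (i \<triangle> t) k))"
    have o: "orthogonal_elems (cd_algebra \<gamma> (Suc n)) (vertex_vec t i s) (vertex_vec t k r)"
      using orthogonal_vertex_iff[of t i t k s r] k nz r_def by simp
    then have o': "orthogonal_elems (cd_algebra \<gamma> (Suc n)) (vertex_vec t k r) (vertex_vec t i s)"
      by (simp add: orthogonal_elems_def)
    have "vertex_vec t i s \<in> basis_zero_divisors \<gamma> n" "vertex_vec t k r \<in> basis_zero_divisors \<gamma> n"
      using vertex_vec_zero_divisor[OF _ _ _ _ _ o] vertex_vec_zero_divisor[OF _ _ _ _ _ o'] k nz by simp_all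
    moreover have "vertex_line t i s \<noteq> vertex_line t k r"
      using k vertex_line_eq_iff[of t n i t k s r] by simp
    ultimately show "M \<in> ?A"
      using o k(5) r_def by (auto simp: Gamma_e_def vertex_line_def)
  qed
qed

lemma card_neighbours_vertex_line:
  assumes "length t = n" "length i = n" "nonzero i"
  shows "card {M. (vertex_line t i s, M) \<in> parcs (Gamma_e \<gamma> n)} = degree_at g n t i"
proof -
  have "inj_on (\<lambda>k. vertex_line t k (s \<noteq> (sgn_mult g (k \<triangle> t) i \<noteq> sgn_mult g (i \<triangle> t) k)))
      {k \<in> vecs n. nonzero k \<and> k \<noteq> i \<and> (chi g t \<noteq> omega t i k) = g n}"
    using assms(1) by (intro inj_onI) (simp add: vertex_line_eq_iff[where n = n])
  then show ?thesis
    unfolding neighbours_vertex_line[OF assms] by (simp only: card_image card_neighbours[OF assms])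
qed

definition pairs_of_degree :: "nat \<Rightarrow> (bool list \<times> bool list) set" where
  "pairs_of_degree d = {(t, i). t \<in> vecs n \<and> i \<in> vecs n \<and> nonzero i \<and> degree_at g n t i = d}"

lemma finite_pairs_of_degree [simp]: "finite (pairs_of_degree d)"
  by (rule finite_subset[of _ "vecs n \<times> vecs n"]) (auto simp: pairs_of_degree_def)

text \<open>The factor 2 counts the two signs \<open>s\<close>. As \<open>d\<close> is positive, a
  candidate line of this degree has a neighbour, hence is a vertex.\<close>

lemma card_vertices_of_degree:
  assumes "d > 0"
  shows "card {L \<in> pverts (Gamma_e \<gamma> n). card {M. (L, M) \<in> parcs (Gamma_e \<gamma> n)} = d} =
    2 * card (pairs_of_degree d)"
proof -
  let ?f = "\<lambda>((t, i), s). vertex_line t i s"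
  have "{L \<in> pverts (Gamma_e \<gamma> n). card {M. (L, M) \<in> parcs (Gamma_e \<gamma> n)} = d} =
      ?f ` (pairs_of_degree d \<times> UNIV)" (is "?A = ?B")
  proof
    show "?A \<subseteq> ?B"
    proof
      fix L assume L: "L \<in> ?A"
      then obtain u where u: "u \<in> basis_zero_divisors \<gamma> n" "L = line u" by (auto simp: Gamma_e_def)
      from u(1) obtain t i s where v: "u = vertex_vec t i s" "length t = n" "length i = n" "nonzero i"
        by (rule basis_zero_divisorsE)
      then have "degree_at g n t i = d"
        using L u card_neighbours_vertex_line[of t i s] by (simp add: vertex_line_def)
      then show "L \<in> ?B"
        using u v by (intro image_eqI[of _ _ "((t, i), s)"]) (simp_all add: vertex_line_def pairs_of_degree_def)
    qed
    show "?B \<subseteq> ?A"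
    proof
      fix L assume "L \<in> ?B"
      then obtain t i s where L: "L = vertex_line t i s" and l: "length t = n" "length i = n" "nonzero i"
        and d: "degree_at g n t i = d" by (auto simp: pairs_of_degree_def)
      have c: "card {M. (L, M) \<in> parcs (Gamma_e \<gamma> n)} = d"
        using card_neighbours_vertex_line[OF l, of s] d L by simp
      then have "{M. (L, M) \<in> parcs (Gamma_e \<gamma> n)} \<noteq> {}" using assms by force
      then have "L \<in> pverts (Gamma_e \<gamma> n)" by (auto simp: Gamma_e_def)
      with c show "L \<in> ?A" by simp
    qed
  qed
  moreover have "inj_on ?f (pairs_of_degree d \<times> UNIV)"
    by (auto simp: inj_on_def pairs_of_degree_def vertex_line_eq_iff[where n = n])
  ultimately show ?thesis by (simp add: card_image card_cartesian_product)
qed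

section \<open>Reading pair counts and the last parameter off the degrees\<close>

lemma degree_at_cases:
  assumes "3 \<le> n" "length t = n" "length i = n"
  shows "omega_count t i \<le> 2 ^ n - 4" "omega_count t i mod 8 = (if ind2 t i then 4 else 0)"
  using omega_count_le[OF assms(2,3)] omega_count_mod_8[OF assms] omega_count_dependent[of t i]
  by (cases "ind2 t i"; simp)+

lemma pair_count_card:
  "pair_count g n m c =
    card {(t, i). t \<in> vecs n \<and> i \<in> vecs n \<and> ind2 t i \<and> omega_count t i = m \<and> chi g t = c}"
proof -
  have "pair_count g n m c = (\<Sum>p\<in>vecs n \<times> vecs n.
      of_bool (case p of (t, i) \<Rightarrow> ind2 t i \<and> omega_count t i = m \<and> chi g t = c))"
    unfolding pair_count_def sum.cartesian_product by (intro sum.cong) auto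
  also have "\<dots> = card {p \<in> vecs n \<times> vecs n. case p of (t, i) \<Rightarrow>
      ind2 t i \<and> omega_count t i = m \<and> chi g t = c}"
    by (simp only: card_filter_sum finite_cartesian_product finite_vecs)
  also have "{p \<in> vecs n \<times> vecs n. case p of (t, i) \<Rightarrow> ind2 t i \<and> omega_count t i = m \<and> chi g t = c} =
      {(t, i). t \<in> vecs n \<and> i \<in> vecs n \<and> ind2 t i \<and> omega_count t i = m \<and> chi g t = c}"
    by auto
  finally show ?thesis .
qed

text \<open>\<open>omega_count\<close> is a multiple of 4 while 2^n - 2 is 2 modulo 4, so the two
  formulas in \<open>degree_at\<close> never meet. Dependent pairs have count 0 and do not
  interfere, since m is 4 modulo 8.\<close>

lemma pair_count_eq_card:
  assumes n: "3 \<le> n" and m: "m mod 8 = 4" "m < 2 ^ n - 2"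
  shows "pair_count g n m (\<not> g n) = card (pairs_of_degree m)"
    "pair_count g n m (g n) = card (pairs_of_degree (2 ^ n - 2 - m))"
proof -
  obtain q :: nat where q: "2 ^ n = 8 * q" using eight_dvd_power[OF n] by blast
  have mod: "8 * q - 2 - x \<noteq> y" if "x mod 8 \<in> {0, 4}" "y mod 8 \<in> {0, 4}" "x < 8 * q - 2" for x y :: nat
  proof
    have "4 dvd z" if "z mod 8 \<in> {0, 4}" for z :: nat
      using that by auto presburger+
    then obtain a b where "x = 4 * a" "y = 4 * b" using \<open>x mod 8 \<in> {0, 4}\<close> \<open>y mod 8 \<in> {0, 4}\<close> by (metis dvdE)
    moreover assume "8 * q - 2 - x = y"
    then have "x + y + 2 = 8 * q" using that(3) by auto
    ultimately have "2 * (a + b) + 1 = 2 * (2 * q)" by simp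
    then show False by (metis dvd_triv_left even_plus_one_iff)
  qed
  have 1: "nonzero i \<and> degree_at g n t i = m \<longleftrightarrow> ind2 t i \<and> omega_count t i = m \<and> chi g t = (\<not> g n)"
    and 2: "nonzero i \<and> degree_at g n t i = 2 ^ n - 2 - m \<longleftrightarrow> ind2 t i \<and> omega_count t i = m \<and> chi g t = g n"
    if l: "length t = n" "length i = n" for t i
  proof -
    have w: "omega_count t i mod 8 \<in> {0, 4}" "omega_count t i < 8 * q - 2"
      using degree_at_cases[OF n l] q n power_increasing[of 3 n "2::nat"] by (auto split: if_splits)
    have "2 ^ n - 2 - omega_count t i \<noteq> m"
      using mod[of "omega_count t i" m] w m by (simp add: q)
    moreover have "omega_count t i \<noteq> 2 ^ n - 2 - m"
      using mod[of m "omega_count t i"] w m by (auto simp: q)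
    moreover have "omega_count t i = m \<Longrightarrow> ind2 t i"
      using m degree_at_cases(2)[OF n l] by (auto split: if_splits)
    moreover have "2 ^ n - 2 - omega_count t i = 2 ^ n - 2 - m \<longleftrightarrow> omega_count t i = m"
      using w m unfolding q by linarith
    moreover have "ind2 t i \<Longrightarrow> nonzero i" by (simp add: ind2_def)
    ultimately show
      "nonzero i \<and> degree_at g n t i = m \<longleftrightarrow> ind2 t i \<and> omega_count t i = m \<and> chi g t = (\<not> g n)"
      "nonzero i \<and> degree_at g n t i = 2 ^ n - 2 - m \<longleftrightarrow> ind2 t i \<and> omega_count t i = m \<and> chi g t = g n"
      by (auto simp: degree_at_def)
  qed
  show "pair_count g n m (\<not> g n) = card (pairs_of_degree m)"
    unfolding pair_count_card pairs_of_degree_def using 1 by (intro arg_cong[where f = card]) (simp add: set_eq_iff; blast)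
  show "pair_count g n m (g n) = card (pairs_of_degree (2 ^ n - 2 - m))"
    unfolding pair_count_card pairs_of_degree_def using 2 by (intro arg_cong[where f = card]) (simp add: set_eq_iff; blast)
qed

text \<open>This degree needs count 0, so t = 0 or t = i. If \<open>g n\<close> fails, t = 0 already
  provides all 2^n - 1 nonzero i. If it holds, t = 0 is excluded and t = i provides only those i
  with \<open>chi g i\<close>, which are fewer.\<close>

lemma card_pairs_of_max_degree:
  assumes n: "3 \<le> n"
  shows "card (pairs_of_degree (2 ^ n - 2)) \<ge> 2 ^ n - 1 \<longleftrightarrow> \<not> g n"
proof -
  have deg: "degree_at g n t i = 2 ^ n - 2 \<longleftrightarrow> chi g t = g n \<and> \<not> ind2 t i"
    if l: "length t = n" "length i = n" for t i
  proof -
    have "(8::nat) \<le> 2 ^ n" using power_increasing[of 3 n "2::nat"] n by simp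
    then show ?thesis
      using degree_at_cases[OF n l] omega_count_dependent[of t i]
      by (cases "ind2 t i"; cases "chi g t = g n"; auto simp: degree_at_def)
  qed
  show ?thesis
  proof (cases "g n")
    case True
    obtain m where m: "n = Suc (Suc m)" using n by (metis Suc_le_D numeral_3_eq_3 Suc_le_mono)
    \<comment> \<open>The character values of \<open>?x\<close>, \<open>?y\<close> and their sum
      cannot all be True, so its kernel contains a nonzero vector.\<close>
    obtain z where z: "length z = n" "nonzero z" "\<not> chi g z"
    proof -
      let ?r = "replicate m False"
      let ?x = "True # False # ?r" and ?y = "False # True # ?r"
      have "\<not> chi g ?x \<or> \<not> chi g ?y \<or> \<not> chi g (?x \<triangle> ?y)"
        using chi_vadd[of ?x ?y g] by auto
      moreover have "length ?x = n" "length ?y = n" "length (?x \<triangle> ?y) = n" using m by simp_all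
      ultimately show ?thesis using that by (metis nonzero_simps(2) nonzero_vadd list.inject)
    qed
    let ?I = "{i \<in> vecs n. nonzero i}"
    have "pairs_of_degree (2 ^ n - 2) \<subseteq> (\<lambda>i. (i, i)) ` (?I - {z})"
    proof
      fix p assume "p \<in> pairs_of_degree (2 ^ n - 2)"
      then obtain t i where p: "p = (t, i)" "length t = n" "length i = n" "nonzero i"
        "degree_at g n t i = 2 ^ n - 2" by (auto simp: pairs_of_degree_def)
      then have "chi g t" "\<not> ind2 t i" using True deg by auto
      then have "t = i" "i \<noteq> z" using p z chi_zero[of t g] by (auto simp: ind2_def)
      then show "p \<in> (\<lambda>i. (i, i)) ` (?I - {z})" using p by simp
    qed
    then have "card (pairs_of_degree (2 ^ n - 2)) \<le> card ((\<lambda>i. (i, i)) ` (?I - {z}))"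
      by (intro card_mono) auto
    also have "\<dots> \<le> card (?I - {z})" by (rule card_image_le) auto
    also have "\<dots> < card ?I" using z by (intro psubset_card_mono) auto
    finally show ?thesis using True card_nonzero[of n] by simp
  next
    case False
    have "(\<lambda>i. (replicate n False, i)) ` {i \<in> vecs n. nonzero i} \<subseteq> pairs_of_degree (2 ^ n - 2)"
    proof
      fix p assume "p \<in> (\<lambda>i. (replicate n False, i)) ` {i \<in> vecs n. nonzero i}"
      then obtain i where p: "p = (replicate n False, i)" "length i = n" "nonzero i" by auto
      then show "p \<in> pairs_of_degree (2 ^ n - 2)"
        using False deg[of "replicate n False" i] by (simp add: pairs_of_degree_def ind2_def)
    qed
    then have "card ((\<lambda>i. (replicate n False, i)) ` {i \<in> vecs n. nonzero i}) \<le> card (pairs_of_degree (2 ^ n - 2))"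
      by (intro card_mono) auto
    then show ?thesis using False card_nonzero[of n] by (simp add: card_image inj_on_def)
  qed
qed

end

section \<open>Isomorphisms\<close>

text \<open>Compatibility with conjugation is included because the doubling formula uses conjugates;
  it lets an isomorphism extend componentwise in \<open>conj_isomorphic_Suc\<close>.\<close>

definition conj_isomorphism :: "(nat \<Rightarrow> real) \<Rightarrow> (nat \<Rightarrow> real) \<Rightarrow> nat \<Rightarrow> (cd \<Rightarrow> cd) \<Rightarrow> bool" where
  "conj_isomorphism \<gamma> \<mu> n \<phi> \<longleftrightarrow>
     bij_betw \<phi> (cd_carrier n) (cd_carrier n) \<and> \<phi> (cd_basis n 0) = cd_basis n 0 \<and>
     (\<forall>x \<in> cd_carrier n. \<phi> (cd_conj x) = cd_conj (\<phi> x) \<and> (\<forall>r. \<phi> (cd_scale r x) = cd_scale r (\<phi> x))) \<and>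
     (\<forall>x \<in> cd_carrier n. \<forall>y \<in> cd_carrier n.
        \<phi> (cd_add x y) = cd_add (\<phi> x) (\<phi> y) \<and> \<phi> (cd_mult \<gamma> n x y) = cd_mult \<mu> n (\<phi> x) (\<phi> y))"

definition conj_isomorphic :: "(nat \<Rightarrow> real) \<Rightarrow> (nat \<Rightarrow> real) \<Rightarrow> nat \<Rightarrow> bool" where
  "conj_isomorphic \<gamma> \<mu> n \<longleftrightarrow> (\<exists>\<phi>. conj_isomorphism \<gamma> \<mu> n \<phi>)"

lemma conj_isomorphic_imp_alg_isomorphic:
  assumes "conj_isomorphic \<gamma> \<mu> n"
  shows "alg_isomorphic (cd_algebra \<gamma> n) (cd_algebra \<mu> n)"
proof -
  obtain \<phi> where \<phi>: "conj_isomorphism \<gamma> \<mu> n \<phi>" using assms by (auto simp: conj_isomorphic_def)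
  then have "\<phi> \<in> ring_iso (cd_algebra \<gamma> n) (cd_algebra \<mu> n)"
    unfolding ring_iso_def
    by (auto simp: conj_isomorphism_def cd_algebra_def intro!: ring_hom_memI dest: bij_betwE)
  with \<phi> show ?thesis
    unfolding alg_isomorphic_def by (intro bexI[of _ \<phi>]) (auto simp: conj_isomorphism_def cd_algebra_def)
qed

lemma cd_basis_carrier [simp]: "cd_basis n 0 \<in> cd_carrier n"
  by (simp add: cd_basis_0)

lemma cd_mult_cong:
  "\<forall>k<n. \<gamma> k = \<mu> k \<Longrightarrow> x \<in> cd_carrier n \<Longrightarrow> y \<in> cd_carrier n \<Longrightarrow> cd_mult \<gamma> n x y = cd_mult \<mu> n x y"
proof (induction n arbitrary: x y)
  case (Suc n)
  from Suc.prems(2,3) show ?case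
    by (elim cd_carrier_SucE) (simp add: Suc.IH Suc.prems(1))
qed auto

lemma conj_isomorphic_cong:
  assumes "\<forall>k<n. \<gamma> k = \<mu> k"
  shows "conj_isomorphic \<gamma> \<mu> n"
proof -
  have "conj_isomorphism \<gamma> \<mu> n id"
    unfolding conj_isomorphism_def using cd_mult_cong[OF assms] by simp
  then show ?thesis by (auto simp: conj_isomorphic_def)
qed

lemma conj_isomorphic_trans:
  assumes "conj_isomorphic \<gamma> \<mu> n" "conj_isomorphic \<mu> \<nu> n"
  shows "conj_isomorphic \<gamma> \<nu> n"
proof -
  obtain \<phi> \<psi> where h: "conj_isomorphism \<gamma> \<mu> n \<phi>" "conj_isomorphism \<mu> \<nu> n \<psi>"
    using assms by (auto simp: conj_isomorphic_def)
  then have "\<forall>x \<in> cd_carrier n. \<phi> x \<in> cd_carrier n"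
    by (auto simp: conj_isomorphism_def dest: bij_betwE)
  with h have "conj_isomorphism \<gamma> \<nu> n (\<psi> \<circ> \<phi>)"
    by (auto simp: conj_isomorphism_def intro: bij_betw_trans)
  then show ?thesis by (auto simp: conj_isomorphic_def)
qed

lemma conj_isomorphic_sym:
  assumes "conj_isomorphic \<gamma> \<mu> n"
  shows "conj_isomorphic \<mu> \<gamma> n"
proof -
  obtain \<phi> where h: "conj_isomorphism \<gamma> \<mu> n \<phi>" using assms by (auto simp: conj_isomorphic_def)
  define \<psi> where "\<psi> = inv_into (cd_carrier n) \<phi>"
  have bij: "bij_betw \<phi> (cd_carrier n) (cd_carrier n)" using h by (simp add: conj_isomorphism_def)
  have \<psi>: "\<psi> x \<in> cd_carrier n" "\<phi> (\<psi> x) = x" if "x \<in> cd_carrier n" for x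
    using bij that unfolding \<psi>_def by (metis bij_betw_def inv_into_into) (metis bij bij_betw_inv_into_right that)
  have eq: "\<psi> y = x" if "x \<in> cd_carrier n" "\<phi> x = y" for x y
    using bij that unfolding \<psi>_def by (metis bij_betw_inv_into_left)
  have "conj_isomorphism \<mu> \<gamma> n \<psi>"
    unfolding conj_isomorphism_def
  proof (intro conjI ballI allI)
    show "bij_betw \<psi> (cd_carrier n) (cd_carrier n)" unfolding \<psi>_def by (rule bij_betw_inv_into[OF bij])
  \<comment> \<open>Each remaining law has the form \<open>\<psi> y = x\<close>, and
    \<open>eq\<close> reduces it to a law for \<open>\<phi>\<close>.\<close>
  qed (rule eq; use h \<psi> in \<open>simp add: conj_isomorphism_def\<close>)+
  then show ?thesis by (auto simp: conj_isomorphic_def)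
qed

primrec map_Dbl :: "(cd \<Rightarrow> cd) \<Rightarrow> cd \<Rightarrow> cd" where
  "map_Dbl f (Scalar x) = Scalar x"
| "map_Dbl f (Dbl a b) = Dbl (f a) (f b)"

lemma conj_isomorphic_Suc:
  assumes "conj_isomorphic \<gamma> \<mu> n" "\<gamma> n = \<mu> n"
  shows "conj_isomorphic \<gamma> \<mu> (Suc n)"
proof -
  obtain \<phi> where h: "conj_isomorphism \<gamma> \<mu> n \<phi>" using assms by (auto simp: conj_isomorphic_def)
  then have bij: "bij_betw \<phi> (cd_carrier n) (cd_carrier n)"
    and one: "\<phi> (cd_basis n 0) = cd_basis n 0"
    and lin: "\<And>x. x \<in> cd_carrier n \<Longrightarrow> \<phi> (cd_conj x) = cd_conj (\<phi> x)"
      "\<And>r x. x \<in> cd_carrier n \<Longrightarrow> \<phi> (cd_scale r x) = cd_scale r (\<phi> x)"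
    and hom: "\<And>x y. x \<in> cd_carrier n \<Longrightarrow> y \<in> cd_carrier n \<Longrightarrow> \<phi> (cd_add x y) = cd_add (\<phi> x) (\<phi> y)"
      "\<And>x y. x \<in> cd_carrier n \<Longrightarrow> y \<in> cd_carrier n \<Longrightarrow> \<phi> (cd_mult \<gamma> n x y) = cd_mult \<mu> n (\<phi> x) (\<phi> y)"
    by (simp_all add: conj_isomorphism_def)
  have closed: "\<phi> x \<in> cd_carrier n" if "x \<in> cd_carrier n" for x
    using bij that by (auto dest: bij_betwE)
  have zero: "\<phi> (cd_zero n) = cd_zero n"
    using lin(2)[of "cd_zero n" 0] cd_scale_0[OF closed[of "cd_zero n"]] by simp
  have "bij_betw (map_Dbl \<phi>) (cd_carrier (Suc n)) (cd_carrier (Suc n))"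
  proof (rule bij_betw_byWitness[where f' = "map_Dbl (inv_into (cd_carrier n) \<phi>)"])
    show "\<forall>x \<in> cd_carrier (Suc n). map_Dbl (inv_into (cd_carrier n) \<phi>) (map_Dbl \<phi> x) = x"
      using bij_betw_inv_into_left[OF bij] by auto
    show "\<forall>x \<in> cd_carrier (Suc n). map_Dbl \<phi> (map_Dbl (inv_into (cd_carrier n) \<phi>) x) = x"
      using bij_betw_inv_into_right[OF bij] by auto
    show "map_Dbl \<phi> ` cd_carrier (Suc n) \<subseteq> cd_carrier (Suc n)" using closed by auto
    show "map_Dbl (inv_into (cd_carrier n) \<phi>) ` cd_carrier (Suc n) \<subseteq> cd_carrier (Suc n)"
      using bij_betwE[OF bij_betw_inv_into[OF bij]] by auto
  qed
  moreover have "map_Dbl \<phi> (cd_mult \<gamma> (Suc n) x y) = cd_mult \<mu> (Suc n) (map_Dbl \<phi> x) (map_Dbl \<phi> y)"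
    if "x \<in> cd_carrier (Suc n)" "y \<in> cd_carrier (Suc n)" for x y
    using that by (elim cd_carrier_SucE) (simp add: lin hom closed assms(2))
  ultimately have "conj_isomorphism \<gamma> \<mu> (Suc n) (map_Dbl \<phi>)"
    unfolding conj_isomorphism_def by (auto simp: one zero lin hom closed)
  then show ?thesis by (auto simp: conj_isomorphic_def)
qed

section \<open>Isomorphisms between algebras of dimension at most 8\<close>

fun swap_units :: "cd \<Rightarrow> cd" where
  "swap_units (Dbl (Dbl a b) (Dbl c d)) = Dbl (Dbl a c) (Dbl b (cd_neg d))"
| "swap_units x = x"

fun twist_unit :: "cd \<Rightarrow> cd" where
  "twist_unit (Dbl x (Dbl p q)) = Dbl x (Dbl (cd_conj q) (cd_conj p))"
| "twist_unit x = x"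

lemma cd_conj_conj [simp]: "cd_conj (cd_conj x) = x"
  by (induction x) auto

lemma cd_conj_add:
  "x \<in> cd_carrier n \<Longrightarrow> y \<in> cd_carrier n \<Longrightarrow> cd_conj (cd_add x y) = cd_add (cd_conj x) (cd_conj y)"
proof (induction n arbitrary: x y)
  case (Suc n)
  then show ?case by (elim cd_carrier_SucE) (simp add: cd_scale_add[where n = n])
qed auto

lemma conj_isomorphismI_involution:
  assumes "\<And>x. x \<in> cd_carrier n \<Longrightarrow> \<phi> x \<in> cd_carrier n" "\<And>x. x \<in> cd_carrier n \<Longrightarrow> \<phi> (\<phi> x) = x"
    and "\<phi> (cd_basis n 0) = cd_basis n 0"
    and "\<And>x. x \<in> cd_carrier n \<Longrightarrow> \<phi> (cd_conj x) = cd_conj (\<phi> x)"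
    and "\<And>r x. x \<in> cd_carrier n \<Longrightarrow> \<phi> (cd_scale r x) = cd_scale r (\<phi> x)"
    and "\<And>x y. x \<in> cd_carrier n \<Longrightarrow> y \<in> cd_carrier n \<Longrightarrow> \<phi> (cd_add x y) = cd_add (\<phi> x) (\<phi> y)"
    and "\<And>x y. x \<in> cd_carrier n \<Longrightarrow> y \<in> cd_carrier n \<Longrightarrow>
           \<phi> (cd_mult \<gamma> n x y) = cd_mult \<mu> n (\<phi> x) (\<phi> y)"
  shows "conj_isomorphic \<gamma> \<mu> n"
proof -
  have "bij_betw \<phi> (cd_carrier n) (cd_carrier n)"
    by (rule bij_betw_byWitness[where f' = \<phi>]) (use assms in auto)
  then have "conj_isomorphism \<gamma> \<mu> n \<phi>" unfolding conj_isomorphism_def using assms by auto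
  then show ?thesis by (auto simp: conj_isomorphic_def)
qed

text \<open>\<open>swap_units\<close> exchanges the last two doubling units. They anticommute, hence
  the negated last quarter. Multiplicativity is checked on real coordinates.\<close>

lemma conj_isomorphic_swap:
  assumes "k \<le> 1" "\<forall>j<k. \<mu> j = \<gamma> j" "\<mu> k = \<gamma> (Suc k)" "\<mu> (Suc k) = \<gamma> k"
  shows "conj_isomorphic \<gamma> \<mu> (Suc (Suc k))"
proof (rule conj_isomorphismI_involution[where \<phi> = swap_units])
  fix x y assume xy: "x \<in> cd_carrier (Suc (Suc k))" "y \<in> cd_carrier (Suc (Suc k))"
  consider "k = 0" | "k = 1" using assms(1) by linarith
  then show "swap_units (cd_mult \<gamma> (Suc (Suc k)) x y) = cd_mult \<mu> (Suc (Suc k)) (swap_units x) (swap_units y)"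
  proof cases
    case 1
    then show ?thesis using xy assms(3,4) by (auto simp: algebra_simps)
  next
    case 2
    then show ?thesis using xy assms(2-4) by (auto simp: algebra_simps)
  qed
qed (auto simp: cd_scale_add[where n = k] mult.commute)

text \<open>The last unit v goes to its product with the preceding unit u, up to order. As u squares
  to 1 and anticommutes with v, this product squares to minus the square of v, which flips the last
  parameter.\<close>

lemma conj_isomorphic_twist:
  assumes "k \<le> 1" "\<forall>j\<le>k. \<mu> j = \<gamma> j" "\<gamma> k = 1" "\<mu> (Suc k) = - \<gamma> (Suc k)"
  shows "conj_isomorphic \<gamma> \<mu> (Suc (Suc k))"
proof (rule conj_isomorphismI_involution[where \<phi> = twist_unit])
  fix x y assume xy: "x \<in> cd_carrier (Suc (Suc k))" "y \<in> cd_carrier (Suc (Suc k))"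
  consider "k = 0" | "k = 1" using assms(1) by linarith
  then show "twist_unit (cd_mult \<gamma> (Suc (Suc k)) x y) = cd_mult \<mu> (Suc (Suc k)) (twist_unit x) (twist_unit y)"
  proof cases
    case 1
    then show ?thesis using xy assms(2-4) by (auto simp: algebra_simps)
  next
    case 2
    then show ?thesis using xy assms(2-4) by (auto simp: algebra_simps)
  qed
qed (auto simp: cd_conj_add[where n = k] cd_conj_scale mult.commute)

text \<open>Swaps move a parameter 1 to position 0. From there a twist turns parameter 1 into 1
  where necessary, and a second twist does the same for parameter 2.\<close>

lemma conj_isomorphic_split_octonions:
  assumes "\<forall>k<3. \<gamma> k \<in> {1, - 1}" and "\<exists>k<3. \<gamma> k = 1"
  shows "conj_isomorphic \<gamma> (\<lambda>_. 1) 3"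
proof -
  have 0: "conj_isomorphic \<gamma> (\<lambda>_. 1) 3" if v: "\<forall>k<3. \<gamma> k \<in> {1, - 1}" and "\<gamma> 0 = 1" for \<gamma> :: "nat \<Rightarrow> real"
  proof -
    let ?\<mu> = "\<gamma>(1 := 1)"
    have "conj_isomorphic \<gamma> ?\<mu> 3"
    proof (cases "\<gamma> 1 = 1")
      case True
      then show ?thesis by (intro conj_isomorphic_cong) simp
    next
      case False
      then have "\<gamma> 1 = - 1" using v[rule_format, of 1] by simp
      then have "conj_isomorphic \<gamma> ?\<mu> (Suc (Suc 0))"
        using that by (intro conj_isomorphic_twist) auto
      from conj_isomorphic_Suc[OF this] show ?thesis by (simp add: numeral_3_eq_3)
    qed
    moreover have "conj_isomorphic ?\<mu> (\<lambda>_. 1) 3"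
    proof (cases "\<gamma> 2 = 1")
      case True
      have "?\<mu> k = 1" if k: "k < 3" for k
      proof -
        consider "k = 0" | "k = 1" | "k = 2" using k by linarith
        then show ?thesis using True \<open>\<gamma> 0 = 1\<close> by cases auto
      qed
      then show ?thesis by (intro conj_isomorphic_cong) simp
    next
      case False
      then have "\<gamma> 2 = - 1" using v[rule_format, of 2] by simp
      then have "conj_isomorphic ?\<mu> (\<lambda>_. 1) (Suc (Suc 1))"
        using that by (intro conj_isomorphic_twist) (auto simp: numeral_2_eq_2 le_Suc_eq)
      then show ?thesis by (simp add: numeral_3_eq_3)
    qed
    ultimately show ?thesis by (rule conj_isomorphic_trans)
  qed
  have 1: "conj_isomorphic \<gamma> (\<lambda>_. 1) 3" if v: "\<forall>k<3. \<gamma> k \<in> {1, - 1}" and "\<gamma> 1 = 1" for \<gamma> :: "nat \<Rightarrow> real"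
  proof -
    let ?\<mu> = "\<gamma>(0 := \<gamma> 1, 1 := \<gamma> 0)"
    have "conj_isomorphic \<gamma> ?\<mu> (Suc (Suc 0))" by (intro conj_isomorphic_swap) auto
    from conj_isomorphic_Suc[OF this] have "conj_isomorphic \<gamma> ?\<mu> 3" by (simp add: numeral_3_eq_3)
    moreover have "conj_isomorphic ?\<mu> (\<lambda>_. 1) 3" using that by (intro 0) auto
    ultimately show ?thesis by (rule conj_isomorphic_trans)
  qed
  have 2: "conj_isomorphic \<gamma> (\<lambda>_. 1) 3" if v: "\<forall>k<3. \<gamma> k \<in> {1, - 1}" and "\<gamma> 2 = 1" for \<gamma> :: "nat \<Rightarrow> real"
  proof -
    let ?\<mu> = "\<gamma>(1 := \<gamma> 2, 2 := \<gamma> 1)"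
    have "conj_isomorphic \<gamma> ?\<mu> (Suc (Suc 1))" by (intro conj_isomorphic_swap) (auto simp: numeral_2_eq_2)
    then have "conj_isomorphic \<gamma> ?\<mu> 3" by (simp add: numeral_3_eq_3)
    moreover have "conj_isomorphic ?\<mu> (\<lambda>_. 1) 3" using that by (intro 1) auto
    ultimately show ?thesis by (rule conj_isomorphic_trans)
  qed
  obtain k where "k < 3" "\<gamma> k = 1" using assms(2) by blast
  then consider "\<gamma> 0 = 1" | "\<gamma> 1 = 1" | "\<gamma> 2 = 1"
    by (metis One_nat_def Suc_1 less_Suc0 less_antisym numeral_3_eq_3 numeral_2_eq_2)
  then show ?thesis using 0 1 2 assms(1) by cases blast+
qed

lemma conj_isomorphic_lift:
  assumes "conj_isomorphic \<gamma> \<mu> m" "m \<le> n" "\<forall>k. m \<le> k \<and> k < n \<longrightarrow> \<gamma> k = \<mu> k"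
  shows "conj_isomorphic \<gamma> \<mu> n"
  using assms(2,3)
proof (induction n rule: dec_induct)
  case base
  show ?case by (rule assms(1))
next
  case (step n)
  then show ?case by (intro conj_isomorphic_Suc) auto
qed

section \<open>Comparison of two graphs\<close>

lemma Gamma_e_arcs_pverts:
  "(L, M) \<in> parcs (Gamma_e \<gamma> n) \<Longrightarrow> L \<in> pverts (Gamma_e \<gamma> n) \<and> M \<in> pverts (Gamma_e \<gamma> n)"
  by (auto simp: Gamma_e_def)

lemma card_vertices_of_degree_isomorphic:
  assumes "graph_isomorphic (Gamma_e \<gamma> n) (Gamma_e \<mu> m)"
  shows "card {L \<in> pverts (Gamma_e \<gamma> n). card {M. (L, M) \<in> parcs (Gamma_e \<gamma> n)} = d} =
    card {L \<in> pverts (Gamma_e \<mu> m). card {M. (L, M) \<in> parcs (Gamma_e \<mu> m)} = d}"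
proof -
  let ?V = "pverts (Gamma_e \<gamma> n)" and ?W = "pverts (Gamma_e \<mu> m)"
  let ?E = "parcs (Gamma_e \<gamma> n)" and ?F = "parcs (Gamma_e \<mu> m)"
  obtain f where f: "bij_betw f ?V ?W"
    and arc: "\<And>L M. L \<in> ?V \<Longrightarrow> M \<in> ?V \<Longrightarrow> (L, M) \<in> ?E \<longleftrightarrow> (f L, f M) \<in> ?F"
    using assms unfolding graph_isomorphic_Gamma_e_iff by blast
  have inj: "inj_on f ?V" and img: "f ` ?V = ?W"
    using f by (simp_all add: bij_betw_def)
  have "card {M. (f L, M) \<in> ?F} = card {M. (L, M) \<in> ?E}" if L: "L \<in> ?V" for L
  proof -
    have sub: "{M. (L, M) \<in> ?E} \<subseteq> ?V" using Gamma_e_arcs_pverts by blast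
    have "{M. (f L, M) \<in> ?F} = f ` {M. (L, M) \<in> ?E}"
    proof (intro subset_antisym subsetI)
      fix M assume M: "M \<in> {M. (f L, M) \<in> ?F}"
      then obtain K where "K \<in> ?V" "M = f K" using Gamma_e_arcs_pverts img by blast
      then show "M \<in> f ` {M. (L, M) \<in> ?E}" using M arc L by blast
    qed (use sub arc L in blast)
    then show ?thesis using inj sub by (simp add: card_image inj_on_subset)
  qed
  then have "{L \<in> ?W. card {M. (L, M) \<in> ?F} = d} = f ` {L \<in> ?V. card {M. (L, M) \<in> ?E} = d}"
    unfolding img[symmetric] by auto
  moreover have "inj_on f {L \<in> ?V. card {M. (L, M) \<in> ?E} = d}"
    using inj by (rule inj_on_subset) auto
  ultimately show ?thesis by (simp add: card_image)
qed

text \<open>The last parameter comes first, since it decides which degrees stand for which character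
  value. Then the pair counts agree, and they yield the other data.\<close>

lemma Gamma_e_determines_params:
  assumes n: "3 \<le> n" and "sign_params \<gamma> g n" "sign_params \<mu> h n"
    and iso: "graph_isomorphic (Gamma_e \<gamma> n) (Gamma_e \<mu> n)"
  shows "(g 0 \<and> g 1 \<and> g 2 \<longleftrightarrow> h 0 \<and> h 1 \<and> h 2) \<and> (\<forall>k. 3 \<le> k \<and> k \<le> n \<longrightarrow> g k = h k)"
proof -
  interpret G: sign_params \<gamma> g n by fact
  interpret H: sign_params \<mu> h n by fact
  have card_eq: "card (G.pairs_of_degree d) = card (H.pairs_of_degree d)" if "d > 0" for d
    using card_vertices_of_degree_isomorphic[OF iso, of d]
    by (simp add: G.card_vertices_of_degree[OF that] H.card_vertices_of_degree[OF that])
  have "(8::nat) \<le> 2 ^ n" using power_increasing[of 3 n "2::nat"] n by simp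
  then have top: "g n = h n"
    using card_eq[of "2 ^ n - 2"] G.card_pairs_of_max_degree[OF n] H.card_pairs_of_max_degree[OF n] by simp
  \<comment> \<open>The bound 2^n - 2 admits m = 4 for n = 3, and it keeps both degrees m and 2^n -
    2 - m positive.\<close>
  have pc: "pair_count g n m c = pair_count h n m c" if m: "m mod 8 = 4" "m < 2 ^ n - 2" for m c
  proof -
    have "m > 0" using m(1) by (cases m) auto
    then have "pair_count g n m (\<not> g n) = pair_count h n m (\<not> g n)"
      "pair_count g n m (g n) = pair_count h n m (g n)"
      using G.pair_count_eq_card[OF n m] H.pair_count_eq_card[OF n m] card_eq[of m]
        card_eq[of "2 ^ n - 2 - m"] m(2) top by simp_all
    then show ?thesis by (cases c; cases "g n") simp_all
  qed
  have "(g 0 \<and> g 1 \<and> g 2 \<longleftrightarrow> h 0 \<and> h 1 \<and> h 2) \<and> (\<forall>k. 3 \<le> k \<and> k < n \<longrightarrow> g k = h k)"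
  proof (cases "n = 3")
    case True
    then have "pair_count g 3 4 True = pair_count h 3 4 True" using pc[of 4 True] by simp
    then show ?thesis using True by (auto simp: pair_count_3 split: if_splits)
  next
    case False
    then show ?thesis using n pc by (intro pair_count_determines) simp_all
  qed
  then show ?thesis using top by (auto simp: le_less)
qed

theorem corollary5p16:
  fixes n :: nat and \<gamma> \<mu> :: "nat \<Rightarrow> real"
  assumes "n \<ge> 3"
    and "\<forall>k\<le>n. \<gamma> k \<in> {1, - 1}"
    and "\<forall>k\<le>n. \<mu> k \<in> {1, - 1}"
    and "graph_isomorphic (Gamma_e \<gamma> n) (Gamma_e \<mu> n)"
  shows "alg_isomorphic (cd_algebra \<gamma> (Suc n)) (cd_algebra \<mu> (Suc n))"
proof -
  let ?g = "\<lambda>k. \<gamma> k = - 1" and ?h = "\<lambda>k. \<mu> k = - 1"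
  have params: "sign_params \<gamma> ?g n" "sign_params \<mu> ?h n"
    using assms(2,3) by (unfold_locales; auto simp: sign_def)+
  have low: "(\<gamma> 0 = - 1 \<and> \<gamma> 1 = - 1 \<and> \<gamma> 2 = - 1) = (\<mu> 0 = - 1 \<and> \<mu> 1 = - 1 \<and> \<mu> 2 = - 1)"
    and high: "\<forall>k. 3 \<le> k \<and> k \<le> n \<longrightarrow> ?g k = ?h k"
    using Gamma_e_determines_params[OF assms(1) params assms(4)] by auto
  have high': "\<forall>k. 3 \<le> k \<and> k < Suc n \<longrightarrow> \<gamma> k = \<mu> k"
    using high assms(2,3) by (metis insertE less_Suc_eq_le singletonD)
  have less_3: "k < 3 \<longleftrightarrow> k = 0 \<or> k = 1 \<or> k = 2" for k :: nat by auto
  \<comment> \<open>Either the first three parameters are -1 on both sides, or both algebras of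
    dimension 8 are the split octonions.\<close>
  have "conj_isomorphic \<gamma> \<mu> 3"
  proof (cases "\<gamma> 0 = - 1 \<and> \<gamma> 1 = - 1 \<and> \<gamma> 2 = - 1")
    case True
    then show ?thesis using low by (intro conj_isomorphic_cong) (auto simp: less_3)
  next
    case False
    have split: "conj_isomorphic \<delta> (\<lambda>_. 1) 3"
      if "\<forall>k\<le>n. \<delta> k \<in> {1, - 1}" "\<not> (\<delta> 0 = - 1 \<and> \<delta> 1 = - 1 \<and> \<delta> 2 = - 1)" for \<delta> :: "nat \<Rightarrow> real"
    proof (rule conj_isomorphic_split_octonions)
      show one_or_minus_one: "\<forall>k<3. \<delta> k \<in> {1, - 1}" using that(1) assms(1) by auto
      show "\<exists>k<3. \<delta> k = 1"
        using that(2) one_or_minus_one[rule_format, of 0] one_or_minus_one[rule_format, of 1] one_or_minus_one[rule_format, of 2]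
        by (auto simp: less_3)
    qed
    have "\<not> (\<mu> 0 = - 1 \<and> \<mu> 1 = - 1 \<and> \<mu> 2 = - 1)" using False low by blast
    from split[OF assms(3) this] split[OF assms(2) False] show ?thesis
      by (blast intro: conj_isomorphic_trans conj_isomorphic_sym)
  qed
  then have "conj_isomorphic \<gamma> \<mu> (Suc n)"
    by (rule conj_isomorphic_lift[OF _ _ high']) (use assms(1) in linarith)
  then show ?thesis by (rule conj_isomorphic_imp_alg_isomorphic)
qed

end
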